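(* Let $A$ be a $d\times n$ integer matrix of rank $d$ with columns $\mathbf{a}_1,\dots,\mathbf{a}_n$ and $\ker(A)\cap\mathbb{R}^n_{\ge 0}=\{\mathbf{0}\}$. Let $\gamma$ be a chamber of $A$, and suppose that the external columns of $A$ lying in $\gamma$ are exactly $\mathbf{a}_1,\dots,\mathbf{a}_\ell$. Assume that the affine semigroup $\mathcal{S}(\mathbf{a}_1,\dots,\mathbf{a}_\ell)$ is saturated in $\mathcal{L}(A)$. Let $\sigma$ be a simplicial cone of $A$ containing $\gamma$, let $M_{\sigma^\vee}$ be the dual ray matrix of $\sigma$ with respect to an ordering $\mathbf{v}_1,\dots,\mathbf{v}_d$ of the minimal ray generators of $\sigma$ in which $\mathbf{v}_i$ is a positive multiple of $\mathbf{a}_i$ for $i=1,\dots,\ell$, and let $B$ be the matrix obtained from $M_{\sigma^\vee}A$ by removing its first $\ell$ rows and first $\ell$ columns. Then there is a chamber $\gamma'$ of $B$ such that $$p_A^{\gamma}(\mathbf{b})=p_B^{\gamma'}\big((M_{\sigma^\vee}\mathbf{b})_{\ell+1},\dots,(M_{\sigma^\vee}\mathbf{b})_d\big)$$ for all $\mathbf{b}\in\gamma\cap\mathcal{S}(A)$.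
   Context: For vectors $\mathbf{u}_1,\dots,\mathbf{u}_k$, $\operatorname{pos}_{\mathbb{R}}(\mathbf{u}_1,\dots,\mathbf{u}_k)$ is the set of their nonnegative real combinations; for a matrix $M$, $\operatorname{pos}_{\mathbb{R}}(M)$ is the cone generated by its columns. For $s\subseteq\{1,\dots,n\}$, $A_s$ is the submatrix of $A$ with columns indexed by $s$, and $A_{\cdot,\hat j}$ is $A$ with column $j$ removed. A simplicial cone of $A$ is $\operatorname{pos}_{\mathbb{R}}(A_s)$ with $|s|=\operatorname{rank}(A_s)=d$. The chamber complex of $A$ is the fan consisting of the cones $\bigcap\{\operatorname{pos}_{\mathbb{R}}(A_s): \operatorname{pos}_{\mathbb{R}}(A_s)\text{ simplicial cone of }A\text{ containing }\mathbf{b}\}$ for $\mathbf{b}\in\operatorname{pos}_{\mathbb{R}}(A)$, together with all their faces; its $d$-dimensional cones are called chambers. The vector partition function is $p_A(\mathbf{b})=\#\{\mathbf{x}\in\mathbb{N}^n: A\mathbf{x}=\mathbf{b}\}$ for $\mathbf{b}\in\mathbb{Z}^d$; it is a piecewise quasi-polynomial, and for a chamber $\gamma$, $p_A^\gamma$ denotes the quasi-polynomial that agrees with $p_A$ on $\gamma\cap\mathbb{Z}^d$ (the same notation is used for any matrix, e.g. $p_B^{\gamma'}$). A column $\mathbf{a}_j$ is an external column of $A$ if $\mathbf{a}_j\notin\operatorname{pos}_{\mathbb{R}}(A_{\cdot,\hat j})$. $\mathcal{L}(A)=\{\sum\lambda_i\mathbf{a}_i:\lambda_i\in\mathbb{Z}\}$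 and $\mathcal{S}(A)=\{\sum\lambda_i\mathbf{a}_i:\lambda_i\in\mathbb{N}\}$; similarly $\mathcal{S}(\cdot)$ of a set of columns. A semigroup $\mathcal{S}(A_s)$ is saturated in $\mathcal{L}(A)$ if $\mathcal{S}(A_s)=\mathcal{L}(A)\cap\operatorname{pos}_{\mathbb{R}}(A_s)$. A minimal ray generator of a ray is its primitive integer generator (integer vector with coprime entries). For a simplicial cone $\sigma$ with ordered minimal ray generators $\mathbf{v}_1,\dots,\mathbf{v}_d$, let $\mathbf{w}_i$ be the primitive integer inner normal of the unique facet of $\sigma$ not containing $\mathbf{v}_i$; the dual ray matrix $M_{\sigma^\vee}$ is the $d\times d$ matrix with rows $\mathbf{w}_1,\dots,\mathbf{w}_d$. *)

theory Defs
  imports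
    "Jordan_Normal_Form.DL_Rank"
    "Jordan_Normal_Form.DL_Submatrix"
    "Jordan_Normal_Form.Matrix_Kernel"
begin

text \<open>Matrices and vectors have dynamic dimensions, because the reduced matrix of the theorem has
  fewer rows and columns than the given one. All indices start at 0, so the first
  \<open>l\<close> columns are those with index in \<open>{..<l}\<close>.\<close>

abbreviation real_vec :: "int vec \<Rightarrow> real vec" where
  "real_vec \<equiv> map_vec real_of_int"

abbreviation real_mat :: "int mat \<Rightarrow> real mat" where
  "real_mat \<equiv> map_mat real_of_int"

abbreviation cols_sub :: "int mat \<Rightarrow> nat set \<Rightarrow> int mat" where
  "cols_sub A s \<equiv> submatrix A UNIV s"

definition pos_cone :: "int mat \<Rightarrow> real vec set" where
  "pos_cone A = {real_mat A *\<^sub>v x | x. x \<in> carrier_vec (dim_col A) \<and> 0\<^sub>v (dim_col A) \<le> x}"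

definition lattice_of :: "int mat \<Rightarrow> int vec set" where
  "lattice_of A = {A *\<^sub>v x | x. x \<in> carrier_vec (dim_col A)}"

definition semigroup_of :: "int mat \<Rightarrow> int vec set" where
  "semigroup_of A = {A *\<^sub>v map_vec int x | x. x \<in> carrier_vec (dim_col A)}"

definition saturated_in :: "int mat \<Rightarrow> int mat \<Rightarrow> bool" where
  "saturated_in C A \<longleftrightarrow> semigroup_of C = {b \<in> lattice_of A. real_vec b \<in> pos_cone C}"

definition external_column :: "int mat \<Rightarrow> nat \<Rightarrow> bool" where
  "external_column A j \<longleftrightarrow>
     j < dim_col A \<and> real_vec (col A j) \<notin> pos_cone (cols_sub A ({..<dim_col A} - {j}))"


subsection \<open>Faces and dimension of cones in real d-space\<close>

text \<open>The choice \<open>u = 0\<close> makes every cone a face of itself.\<close>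

definition is_face :: "nat \<Rightarrow> real vec set \<Rightarrow> real vec set \<Rightarrow> bool" where
  "is_face d F C \<longleftrightarrow>
     (\<exists>u \<in> carrier_vec d. (\<forall>x \<in> C. 0 \<le> u \<bullet> x) \<and> F = {x \<in> C. u \<bullet> x = 0})"

text \<open>The dimension of a cone is the dimension of its linear span (cf. \<open>vec_space.rank\<close>).\<close>

definition cone_dim :: "nat \<Rightarrow> real vec set \<Rightarrow> nat" where
  "cone_dim d C = vectorspace.dim class_ring
     ((module_vec TYPE(real) d)
        \<lparr>carrier := LinearCombinations.module.span class_ring (module_vec TYPE(real) d) C\<rparr>)"

definition is_facet :: "nat \<Rightarrow> real vec set \<Rightarrow> real vec set \<Rightarrow> bool" where
  "is_facet d F C \<longleftrightarrow> is_face d F C \<and> cone_dim d F + 1 = cone_dim d C"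


subsection \<open>Simplicial cones and the chamber complex\<close>

definition simplicial_cones :: "int mat \<Rightarrow> real vec set set" where
  "simplicial_cones A = {pos_cone (cols_sub A s) | s. s \<subseteq> {..<dim_col A} \<and>
     card s = dim_row A \<and> vec_space.rank (dim_row A) (real_mat (cols_sub A s)) = dim_row A}"

definition chamber_cell :: "int mat \<Rightarrow> real vec \<Rightarrow> real vec set" where
  "chamber_cell A b = \<Inter> {\<tau> \<in> simplicial_cones A. b \<in> \<tau>}"

definition chamber_complex :: "int mat \<Rightarrow> real vec set set" where
  "chamber_complex A = {F. \<exists>b \<in> pos_cone A. is_face (dim_row A) F (chamber_cell A b)}"

definition chambers :: "int mat \<Rightarrow> real vec set set" where
  "chambers A = {\<gamma> \<in> chamber_complex A. cone_dim (dim_row A) \<gamma> = dim_row A}"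


subsection \<open>Vector partition function and quasi-polynomials\<close>

definition vpf :: "int mat \<Rightarrow> int vec \<Rightarrow> nat" where
  "vpf A b = card {x \<in> carrier_vec (dim_col A). A *\<^sub>v map_vec int x = b}"

definition polynomial_fun :: "nat \<Rightarrow> (int vec \<Rightarrow> rat) \<Rightarrow> bool" where
  "polynomial_fun d g \<longleftrightarrow>
     (\<exists>(E :: nat vec set) c. finite E \<and> E \<subseteq> carrier_vec d \<and>
        (\<forall>b \<in> carrier_vec d. g b = (\<Sum>e\<in>E. c e * (\<Prod>i<d. of_int (b $ i) ^ (e $ i)))))"

text \<open>A quasi-polynomial coincides with a polynomial on each coset of some sublattice of finite
  index; as every such sublattice of the integer lattice contains all multiples of some
  \<open>N > 0\<close>, it is enough to consider residue classes modulo \<open>N\<close>.\<close>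

definition quasi_polynomial :: "nat \<Rightarrow> (int vec \<Rightarrow> rat) \<Rightarrow> bool" where
  "quasi_polynomial d f \<longleftrightarrow>
     (\<exists>N > (0::int). \<forall>r \<in> carrier_vec d. \<exists>g. polynomial_fun d g \<and>
        (\<forall>b \<in> carrier_vec d. (\<forall>i<d. b $ i mod N = r $ i mod N) \<longrightarrow> f b = g b))"

text \<open>\<open>chamber_qp A \<gamma> q\<close>: \<open>q\<close> is the quasi-polynomial that agrees with the vector partition
  function of \<open>A\<close> on the integer points of the chamber \<open>\<gamma>\<close>. Since \<open>\<gamma>\<close> is full-dimensional,
  \<open>q\<close> is uniquely determined on integer vectors of the right dimension.\<close>

definition chamber_qp :: "int mat \<Rightarrow> real vec set \<Rightarrow> (int vec \<Rightarrow> rat) \<Rightarrow> bool" where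
  "chamber_qp A \<gamma> q \<longleftrightarrow> quasi_polynomial (dim_row A) q \<and>
     (\<forall>b \<in> carrier_vec (dim_row A). real_vec b \<in> \<gamma> \<longrightarrow> q b = of_nat (vpf A b))"


subsection \<open>Minimal ray generators and dual ray matrices\<close>

definition primitive_vec :: "int vec \<Rightarrow> bool" where
  "primitive_vec v \<longleftrightarrow> Gcd (vec_set v) = 1"

definition minimal_ray_generators :: "nat \<Rightarrow> real vec set \<Rightarrow> int vec set" where
  "minimal_ray_generators d \<sigma> =
     {v \<in> carrier_vec d. primitive_vec v \<and> is_face d (pos_cone (mat_of_cols d [v])) \<sigma>}"

definition primitive_inner_normal ::
  "nat \<Rightarrow> real vec set \<Rightarrow> real vec set \<Rightarrow> int vec \<Rightarrow> bool" where
  "primitive_inner_normal d \<sigma> F w \<longleftrightarrow> w \<in> carrier_vec d \<and> primitive_vec w \<and>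
     (\<forall>x \<in> \<sigma>. 0 \<le> real_vec w \<bullet> x) \<and> F = {x \<in> \<sigma>. real_vec w \<bullet> x = 0}"

definition dual_ray_matrix :: "nat \<Rightarrow> real vec set \<Rightarrow> int vec list \<Rightarrow> int mat \<Rightarrow> bool" where
  "dual_ray_matrix d \<sigma> vs M \<longleftrightarrow> M \<in> carrier_mat d d \<and>
     (\<forall>i<d. \<exists>F. is_facet d F \<sigma> \<and> real_vec (vs ! i) \<notin> F \<and>
        primitive_inner_normal d \<sigma> F (row M i))"

end

theory Submission
  imports Defs
begin

text \<open>Pivoting as in the simplex algorithm shows that a point in the interior of \<open>\<gamma>\<close> lies only in cones of
  column sets containing a basis whose cone contains \<open>\<gamma>\<close>. Hence, if a point of \<open>\<gamma>\<close> is written as a combination of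
  the columns in which those outside \<open>{..<l}\<close> have nonnegative coefficients, then the
  coefficients of the external columns of \<open>\<gamma>\<close> are nonnegative too. The last \<open>d - l\<close> rows of the dual
  ray matrix define the projection along these external columns. By the sign property, the
  projection of \<open>\<gamma>\<close> is a chamber of \<open>B\<close>, and, by saturation, every solution of the projected
  system lifts to a unique solution of the original one, so the two counts agree.\<close>

subsection \<open>Dimension of cones\<close>

text \<open>Two obstacles shape the proof. The point \<open>b0\<close> with \<gamma> =
  \<open>chamber_cell A b0\<close> may lie on the boundary of \<gamma>: if three pairwise
  non-parallel columns generate a pointed cone in the plane, an extreme column already has a
  two-dimensional cell. So the relevant bases are selected by \<open>b0\<close>, whereas strict
  inequalities have to come from a separate interior point. For the same reason, bases are carried
  from \<open>B\<close> back to \<open>A\<close> by the signs of coefficients and not by a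
  genericity argument. The other obstacle is that no quasi-polynomial for \<open>B\<close> is given;
  it has to be manufactured from \<open>pA\<close>. The image of the lattice of \<open>A\<close>
  under the projection has finite index but can be a proper sublattice, for instance for the matrix
  with the single row (2, 2) and \<open>l\<close> = 0. The new function therefore vanishes on the
  residue classes that miss this image. On the other classes it must be right at every point of the
  projected chamber, including those whose chosen lift is not in \<gamma>.\<close>

lemma (in vec_space) dim_span_le_card:
  assumes S: "finite S" "S \<subseteq> carrier_vec n" and C: "C \<subseteq> span S"
  shows "vectorspace.dim class_ring (vs (span C)) \<le> card S"
proof -
  let ?P = "\<lambda>T. T \<subseteq> C \<and> lin_indpt T"
  have CV: "C \<subseteq> carrier_vec n" using C span_is_subset2[of S] S by auto
  have "finite T \<and> card T \<le> n" if "?P T" for T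
    using li_le_dim[of T] that CV dim_is_n by auto
  moreover have "?P {}" by (simp add: lin_dep_def)
  \<comment> \<open>\<open>C\<close> is usually infinite; the bound \<open>n\<close> on the size of
    independent sets is what makes a maximal one exist.\<close>
  ultimately obtain U where U: "finite U" "maximal U ?P"
    using maximal_exists[of ?P n "{}"] by blast
  then have UC: "U \<subseteq> C" and li: "lin_indpt U" by (auto simp: maximal_def)
  then have UV: "U \<subseteq> carrier_vec n" using CV by auto
  have "C \<subseteq> span U"
  proof
    fix v assume v: "v \<in> C"
    show "v \<in> span U"
    proof (cases "v \<in> U")
      case True then show ?thesis using in_own_span[of U] UV by auto
    next
      case False
      have "lin_dep (U \<union> {v})"
      proof (rule ccontr)
        assume "\<not> lin_dep (U \<union> {v})"
        then have "?P (U \<union> {v})" using UC v by auto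
        then have "U \<union> {v} = U" using U(2) unfolding maximal_def by blast
        then show False using False by auto
      qed
      then show ?thesis using lin_dep_iff_in_span[of U v] UV li v CV False by auto
    qed
  qed
  then have "span C \<subseteq> span U" using span_is_subset[of C "span U"] span_is_submodule[of U] UV by auto
  moreover have "span U \<subseteq> span C" using span_is_monotone UC by blast
  ultimately have eq: "span C = span U" by auto
  have "maximal U (\<lambda>T. T \<subseteq> U \<and> lin_indpt T)" using li unfolding maximal_def by auto
  then have "vectorspace.dim class_ring (vs (span U)) = card U"
    using dim_span[of U U] UV U(1) by simp
  moreover have "card U \<le> card S"
  proof -
    \<comment> \<open>Steinitz replacement: the complementing set has nonnegative size, which is
      already the inequality.\<close>
    obtain D :: "'a vec set" where "int (card D) \<le> int (card S) - int (card U)"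
      using replacement[of U S] U(1) S li subset_trans[OF UC C] by auto
    then show ?thesis by linarith
  qed
  ultimately show ?thesis using eq by simp
qed

lemma cone_dim_le_card:
  fixes g :: "'i \<Rightarrow> real vec"
  assumes s: "finite s" and g: "\<And>j. j \<in> s \<Longrightarrow> g j \<in> carrier_vec d"
    and C: "\<And>v. v \<in> C \<Longrightarrow> \<exists>x. v = vec d (\<lambda>i. \<Sum>j\<in>s. g j $ i * x j)"
  shows "cone_dim d C \<le> card s"
proof -
  interpret vec_space "TYPE(real)" d .
  have gs: "g ` s \<subseteq> carrier_vec d" using g by auto
  have sub: "submodule class_ring (span (g ` s)) V" using span_is_submodule gs by simp
  have "vec d (\<lambda>i. \<Sum>j\<in>t. g j $ i * x j) \<in> span (g ` s)" if "finite t" "t \<subseteq> s" for t x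
    using that
  proof (induction t)
    case empty
    have "vec d (\<lambda>i. \<Sum>j\<in>{}. g j $ i * x j) = 0\<^sub>v d" by auto
    then show ?case using submodule.zero_closed[OF sub] by simp
  next
    case (insert k t)
    have "g k \<in> span (g ` s)" using in_own_span[of "g ` s"] gs insert.prems by auto
    then have "x k \<cdot>\<^sub>v g k \<in> span (g ` s)"
      using submodule.smult_closed[OF sub, of "x k" "g k"] by simp
    moreover have "vec d (\<lambda>i. \<Sum>j\<in>insert k t. g j $ i * x j)
        = x k \<cdot>\<^sub>v g k + vec d (\<lambda>i. \<Sum>j\<in>t. g j $ i * x j)"
      using insert.hyps g[of k] insert.prems by (intro eq_vecI) (auto simp: mult.commute)
    ultimately show ?case
      using submodule.m_closed[OF sub] insert by auto
  qed
  then have "C \<subseteq> span (g ` s)" using C s by blast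
  then have "cone_dim d C \<le> card (g ` s)"
    unfolding cone_dim_def using dim_span_le_card[of "g ` s" C] s gs by simp
  then show ?thesis using card_image_le[OF s, of g] by linarith
qed

text \<open>This turns dimension into a statement about functionals. It serves twice: the normal of
  a full-dimensional face must be zero, and no facet functional vanishes identically on a
  full-dimensional cell.\<close>

lemma orthogonal_to_full_dim:
  assumes C: "C \<subseteq> carrier_vec d" "cone_dim d C = d"
    and u: "u \<in> carrier_vec d" "\<And>x. x \<in> C \<Longrightarrow> u \<bullet> x = 0"
  shows "u = 0\<^sub>v d"
proof (rule ccontr)
  assume "u \<noteq> 0\<^sub>v d"
  then obtain k where k: "k < d" "u $ k \<noteq> 0"
    using u(1) by (metis carrier_vecD eq_vecI index_zero_vec)
  \<comment> \<open>For j \<noteq> k these d - 1 vectors span the hyperplane orthogonal to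
    \<open>u\<close>, and the entries of a vector of the hyperplane other than the k-th are its
    coefficients.\<close>
  define g where "g j = unit_vec d j - (u $ j / u $ k) \<cdot>\<^sub>v unit_vec d k" for j
  have "cone_dim d C \<le> card ({..<d} - {k})"
  proof (rule cone_dim_le_card[of _ g])
    fix v assume v: "v \<in> C"
    then have vd: "v \<in> carrier_vec d" using C by auto
    have "0 = (\<Sum>j<d. u $ j * v $ j)"
      using u(2)[OF v] vd by (simp add: scalar_prod_def atLeast0LessThan)
    also have "\<dots> = u $ k * v $ k + (\<Sum>j\<in>{..<d} - {k}. u $ j * v $ j)"
      using k by (subst sum.remove[of _ k]) auto
    finally have vk: "v $ k = - (\<Sum>j\<in>{..<d} - {k}. u $ j / u $ k * v $ j)"
      using k(2) by (simp add: sum_divide_distrib[symmetric] field_simps eq_neg_iff_add_eq_0)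
    have eq: "v $ i = (\<Sum>j\<in>{..<d} - {k}. g j $ i * v $ j)" if i: "i < d" for i
    proof (cases "i = k")
      case True
      have "(\<Sum>j\<in>{..<d} - {k}. g j $ i * v $ j)
        = (\<Sum>j\<in>{..<d} - {k}. - (u $ j / u $ k * v $ j))"
        using i True by (intro sum.cong) (auto simp: g_def)
      then show ?thesis using vk True by (simp add: sum_negf)
    next
      case False
      have "(\<Sum>j\<in>{..<d} - {k}. g j $ i * v $ j)
        = (\<Sum>j\<in>{..<d} - {k}. if j = i then v $ i else 0)"
        using i False k(1) by (intro sum.cong) (auto simp: g_def)
      then show ?thesis using False i by (simp add: sum.delta)
    qed
    have "v = vec d (\<lambda>i. \<Sum>j\<in>{..<d} - {k}. g j $ i * v $ j)"
      by (rule eq_vecI, subst eq) (use vd in auto)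
    then show "\<exists>x. v = vec d (\<lambda>i. \<Sum>j\<in>{..<d} - {k}. g j $ i * x j)" by blast
  qed (auto simp: g_def)
  then show False using C(2) k by (simp add: card_Diff_singleton)
qed

text \<open>Writing every vector as a difference of two cone elements is the form of full dimension
  that passes through a linear surjection.\<close>

lemma cone_dim_full:
  assumes C: "C \<subseteq> carrier_vec d"
    and diff: "\<And>v. v \<in> carrier_vec d \<Longrightarrow> \<exists>x\<in>C. \<exists>y\<in>C. v = x - y"
  shows "cone_dim d C = d"
proof -
  interpret vec_space "TYPE(real)" d .
  have sub: "submodule class_ring (span C) V" using span_is_submodule C by simp
  have "carrier_vec d \<subseteq> span C"
  proof
    fix v :: "real vec" assume v: "v \<in> carrier_vec d"
    then obtain x y where xy: "x \<in> C" "y \<in> C" "v = x - y" using diff by blast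
    then have "x \<in> span C" "y \<in> span C" using in_own_span[of C] C by auto
    then have "x + (-1) \<cdot>\<^sub>v y \<in> span C"
      using submodule.m_closed[OF sub] submodule.smult_closed[OF sub, of "-1" y] by simp
    moreover have "v = x + (-1) \<cdot>\<^sub>v y" using xy C by auto
    ultimately show "v \<in> span C" by simp
  qed
  then have "span C = carrier_vec d" using span_is_subset2[of C] C by auto
  then have "vs (span C) = V" by (simp add: module_vec_def)
  then show ?thesis unfolding cone_dim_def using dim_is_n by simp
qed

subsection \<open>Cones and bases formed by columns\<close>

text \<open>Columns keep their index in \<open>A\<close>, and coefficients outside \<open>s\<close>
  are ignored. Supports can thus be compared, exchanged and shifted, which the renumbering inside
  \<open>cols_sub\<close> would obscure.\<close>

definition comb :: "int mat \<Rightarrow> nat set \<Rightarrow> (nat \<Rightarrow> real) \<Rightarrow> real vec" where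
  "comb A s x = vec (dim_row A) (\<lambda>i. \<Sum>j\<in>s. of_int (A $$ (i, j)) * x j)"

definition col_cone :: "int mat \<Rightarrow> nat set \<Rightarrow> real vec set" where
  "col_cone A s = {comb A s x | x. \<forall>j\<in>s. 0 \<le> x j}"

definition col_basis :: "int mat \<Rightarrow> nat set \<Rightarrow> bool" where
  "col_basis A s \<longleftrightarrow> s \<subseteq> {..<dim_col A} \<and> card s = dim_row A \<and>
     (\<forall>x. comb A s x = 0\<^sub>v (dim_row A) \<longrightarrow> (\<forall>j\<in>s. x j = 0))"

lemma comb_carrier [simp]: "comb A s x \<in> carrier_vec (dim_row A)"
  and dim_comb [simp]: "dim_vec (comb A s x) = dim_row A"
  by (auto simp: comb_def)

lemma index_comb: "i < dim_row A \<Longrightarrow> comb A s x $ i = (\<Sum>j\<in>s. of_int (A $$ (i, j)) * x j)"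
  by (simp add: comb_def)

lemma comb_cong: "(\<And>j. j \<in> s \<Longrightarrow> x j = y j) \<Longrightarrow> comb A s x = comb A s y"
  by (auto simp: comb_def intro!: eq_vecI sum.cong)

lemma comb_add: "comb A s (\<lambda>j. x j + y j) = comb A s x + comb A s y"
  by (auto simp: comb_def intro!: eq_vecI) (simp add: algebra_simps sum.distrib)

lemma comb_diff: "comb A s (\<lambda>j. x j - y j) = comb A s x - comb A s y"
  by (auto simp: comb_def intro!: eq_vecI) (simp add: algebra_simps sum_subtractf)

lemma comb_smult: "comb A s (\<lambda>j. c * x j) = c \<cdot>\<^sub>v comb A s x"
  by (auto simp: comb_def intro!: eq_vecI) (simp add: algebra_simps sum_distrib_left)

lemma comb_superset:
  "finite t \<Longrightarrow> s \<subseteq> t \<Longrightarrow> comb A t (\<lambda>j. if j \<in> s then x j else 0) = comb A s x"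
  by (auto simp: comb_def if_distrib if_distribR sum.If_cases Int_absorb1 intro!: eq_vecI cong: if_cong)

lemma comb_Un:
  "finite s \<Longrightarrow> finite t \<Longrightarrow> s \<inter> t = {} \<Longrightarrow> comb A (s \<union> t) x = comb A s x + comb A t x"
  by (auto simp: comb_def sum.union_disjoint intro!: eq_vecI)

lemma comb_delta:
  assumes "finite s" "j \<in> s" "j < dim_col A"
  shows "comb A s (\<lambda>k. if k = j then c else 0) = c \<cdot>\<^sub>v real_vec (col A j)"
  using assms by (auto simp: comb_def if_distrib sum.delta intro!: eq_vecI cong: if_cong)

lemma comb_eq_mat_mult:
  assumes "x \<in> carrier_vec (dim_col A)"
  shows "real_mat A *\<^sub>v x = comb A {..<dim_col A} (\<lambda>j. x $ j)"
  using assms by (auto simp: comb_def scalar_prod_def atLeast0LessThan intro!: eq_vecI)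

section \<open>Column selections as submatrices\<close>

lemma pick_bij:
  fixes s :: "nat set"
  assumes "finite s"
  shows "bij_betw (pick s) {..<card s} s"
proof -
  have inj: "inj_on (pick s) {..<card s}"
  proof (rule inj_onI)
    fix a b assume ab: "a \<in> {..<card s}" "b \<in> {..<card s}" "pick s a = pick s b"
    show "a = b"
    proof (rule ccontr)
      assume "a \<noteq> b"
      then consider "a < b" | "b < a" by linarith
      then show False using pick_mono[of b s a] pick_mono[of a s b] ab by cases auto
    qed
  qed
  have sub: "pick s ` {..<card s} \<subseteq> s" using pick_in_set by auto
  have "pick s ` {..<card s} = s"
    using card_image[OF inj] by (intro card_subset_eq[OF assms sub]) simp
  with inj show ?thesis unfolding bij_betw_def by auto
qed

lemma submatrix_cols:
  assumes s: "s \<subseteq> {..<dim_col A}"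
  shows "dim_row (cols_sub A s) = dim_row A" "dim_col (cols_sub A s) = card s"
    "i < dim_row A \<Longrightarrow> j < card s \<Longrightarrow> cols_sub A s $$ (i, j) = A $$ (i, pick s j)"
proof -
  have [simp]: "{j. j < dim_col A \<and> j \<in> s} = s" using s by auto
  show "dim_row (cols_sub A s) = dim_row A" "dim_col (cols_sub A s) = card s"
    "i < dim_row A \<Longrightarrow> j < card s \<Longrightarrow> cols_sub A s $$ (i, j) = A $$ (i, pick s j)"
    by (auto simp: submatrix_def pick_UNIV)
qed

lemma comb_cols_sub:
  assumes s: "s \<subseteq> {..<dim_col A}"
  shows "real_mat (cols_sub A s) *\<^sub>v vec (card s) (\<lambda>k. x (pick s k)) = comb A s x"
proof (intro eq_vecI)
  fix i assume "i < dim_vec (comb A s x)"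
  then have i: "i < dim_row A" by simp
  have fin: "finite s" using s finite_subset by blast
  have "(real_mat (cols_sub A s) *\<^sub>v vec (card s) (\<lambda>k. x (pick s k))) $ i
      = (\<Sum>k<card s. of_int (A $$ (i, pick s k)) * x (pick s k))"
    using i s by (auto simp: scalar_prod_def submatrix_cols atLeast0LessThan intro!: sum.cong)
  also have "\<dots> = (\<Sum>j\<in>s. of_int (A $$ (i, j)) * x j)"
    by (rule sum.reindex_bij_betw[OF pick_bij[OF fin]])
  finally show "(real_mat (cols_sub A s) *\<^sub>v vec (card s) (\<lambda>k. x (pick s k))) $ i = comb A s x $ i"
    using i by (simp add: index_comb)
qed (use s in \<open>simp add: submatrix_cols\<close>)

lemma vec_over_pick:
  fixes s :: "nat set"
  assumes "finite s" "y \<in> carrier_vec (card s)"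
  obtains x where "y = vec (card s) (\<lambda>k. x (pick s k))"
proof
  show "y = vec (card s) (\<lambda>k. y $ (the_inv_into {..<card s} (pick s) (pick s k)))"
    using assms pick_bij[OF assms(1)]
    by (auto simp: the_inv_into_f_f bij_betw_def intro!: eq_vecI)
qed

lemma pos_cone_cols_sub:
  assumes s: "s \<subseteq> {..<dim_col A}"
  shows "pos_cone (cols_sub A s) = col_cone A s"
proof -
  have fin: "finite s" using s finite_subset by blast
  have bij: "bij_betw (pick s) {..<card s} s" by (rule pick_bij[OF fin])
  show ?thesis
  proof (intro equalityI subsetI)
    fix v assume "v \<in> pos_cone (cols_sub A s)"
    then obtain y where y: "y \<in> carrier_vec (card s)" "0\<^sub>v (card s) \<le> y"
        "v = real_mat (cols_sub A s) *\<^sub>v y"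
      using s by (auto simp: pos_cone_def submatrix_cols)
    then obtain x where x: "y = vec (card s) (\<lambda>k. x (pick s k))" using vec_over_pick[OF fin] by blast
    have "\<forall>j\<in>s. 0 \<le> x j"
    proof
      fix j assume "j \<in> s"
      then obtain k where "k < card s" "j = pick s k" using bij by (auto simp: bij_betw_def)
      then show "0 \<le> x j" using y(2) by (auto simp: x less_eq_vec_def)
    qed
    then show "v \<in> col_cone A s" using y(3) comb_cols_sub[OF s] x by (auto simp: col_cone_def)
  next
    fix v assume "v \<in> col_cone A s"
    then obtain x where x: "\<forall>j\<in>s. 0 \<le> x j" "v = comb A s x" by (auto simp: col_cone_def)
    have "0\<^sub>v (card s) \<le> vec (card s) (\<lambda>k. x (pick s k))"
      using x(1) pick_in_set by (auto simp: less_eq_vec_def)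
    then show "v \<in> pos_cone (cols_sub A s)"
      using x(2) comb_cols_sub[OF s, symmetric] s by (auto simp: pos_cone_def submatrix_cols)
  qed
qed

lemma pos_cone_eq_col_cone: "pos_cone A = col_cone A {..<dim_col A}"
proof (intro equalityI subsetI)
  fix v assume "v \<in> pos_cone A"
  then obtain x where x: "x \<in> carrier_vec (dim_col A)" "0\<^sub>v (dim_col A) \<le> x"
      "v = real_mat A *\<^sub>v x"
    by (auto simp: pos_cone_def)
  then have "v = comb A {..<dim_col A} (\<lambda>j. x $ j)" "\<forall>j\<in>{..<dim_col A}. 0 \<le> x $ j"
    by (simp_all add: comb_eq_mat_mult less_eq_vec_def)
  then show "v \<in> col_cone A {..<dim_col A}" unfolding col_cone_def by blast
next
  fix v assume "v \<in> col_cone A {..<dim_col A}"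
  then obtain x where x: "\<forall>j<dim_col A. 0 \<le> x j" "v = comb A {..<dim_col A} x"
    by (auto simp: col_cone_def)
  have "v = real_mat A *\<^sub>v vec (dim_col A) x"
    unfolding x(2) by (subst comb_eq_mat_mult) (auto intro: comb_cong)
  moreover have "0\<^sub>v (dim_col A) \<le> vec (dim_col A) x" using x(1) by (simp add: less_eq_vec_def)
  ultimately show "v \<in> pos_cone A" unfolding pos_cone_def by (metis (mono_tags, lifting) mem_Collect_eq vec_carrier)
qed

text \<open>The submatrix is square, so full rank, nonzero determinant and trivial kernel coincide;
  \<open>pick\<close> only renames the coefficients.\<close>

lemma col_basis_iff_rank:
  assumes s: "s \<subseteq> {..<dim_col A}" and card: "card s = dim_row A"
  shows "col_basis A s \<longleftrightarrow> vec_space.rank (dim_row A) (real_mat (cols_sub A s)) = dim_row A"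
proof -
  let ?S = "real_mat (cols_sub A s)"
  have fin: "finite s" using s finite_subset by blast
  have S: "?S \<in> carrier_mat (dim_row A) (dim_row A)" 
    by (rule carrier_matI) (simp_all add: submatrix_cols[OF s] card)
  have zero: "vec (card s) (\<lambda>k. x (pick s k)) = 0\<^sub>v (card s) \<longleftrightarrow> (\<forall>j\<in>s. x j = (0::real))" for x
  proof -
    have "vec (card s) (\<lambda>k. x (pick s k)) = 0\<^sub>v (card s) \<longleftrightarrow> (\<forall>k\<in>{..<card s}. x (pick s k) = 0)"
      by (auto simp: vec_eq_iff)
    also have "\<dots> \<longleftrightarrow> (\<forall>j\<in>pick s ` {..<card s}. x j = 0)" by blast
    also have "pick s ` {..<card s} = s" using pick_bij[OF fin] by (simp add: bij_betw_def)
    finally show ?thesis .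
  qed
  have "vec_space.rank (dim_row A) ?S = dim_row A \<longleftrightarrow>
      \<not> (\<exists>y. y \<in> carrier_vec (dim_row A) \<and> y \<noteq> 0\<^sub>v (dim_row A) \<and> ?S *\<^sub>v y = 0\<^sub>v (dim_row A))"
    using vec_space.det_rank_iff[OF S] det_0_iff_vec_prod_zero[OF S] by blast
  also have "\<dots> \<longleftrightarrow> (\<forall>x. comb A s x = 0\<^sub>v (dim_row A) \<longrightarrow> (\<forall>j\<in>s. x j = 0))"
  proof (intro iffI allI impI)
    fix x
    assume "\<not> (\<exists>y. y \<in> carrier_vec (dim_row A) \<and> y \<noteq> 0\<^sub>v (dim_row A) \<and> ?S *\<^sub>v y = 0\<^sub>v (dim_row A))"
      and "comb A s x = 0\<^sub>v (dim_row A)"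
    then have "vec (card s) (\<lambda>k. x (pick s k)) = 0\<^sub>v (card s)"
      using comb_cols_sub[OF s, of x] card vec_carrier by metis
    then show "\<forall>j\<in>s. x j = 0" using zero by simp
  next
    assume a: "\<forall>x. comb A s x = 0\<^sub>v (dim_row A) \<longrightarrow> (\<forall>j\<in>s. x j = 0)"
    show "\<not> (\<exists>y. y \<in> carrier_vec (dim_row A) \<and> y \<noteq> 0\<^sub>v (dim_row A) \<and> ?S *\<^sub>v y = 0\<^sub>v (dim_row A))"
    proof safe
      fix y :: "real vec" assume y: "y \<in> carrier_vec (dim_row A)" "?S *\<^sub>v y = 0\<^sub>v (dim_row A)" "y \<noteq> 0\<^sub>v (dim_row A)"
      obtain x where "y = vec (card s) (\<lambda>k. x (pick s k))" using vec_over_pick[OF fin] y(1) card by metis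
      then show False using a y comb_cols_sub[OF s, of x] zero[of x] card by auto
    qed
  qed
  finally show ?thesis using s card by (auto simp: col_basis_def)
qed

lemma simplicial_cones_eq: "simplicial_cones A = col_cone A ` {s. col_basis A s}"
proof -
  have "simplicial_cones A = {pos_cone (cols_sub A s) | s. col_basis A s}"
    unfolding simplicial_cones_def using col_basis_iff_rank[of _ A] by (auto simp: col_basis_def)
  also have "\<dots> = {col_cone A s | s. col_basis A s}"
    using pos_cone_cols_sub[of _ A] by (metis col_basis_def)
  finally show ?thesis by auto
qed

section \<open>Dual bases and facet inequalities of simplicial cones\<close>

lemma dual_basis_exists:
  assumes s: "col_basis A s"
  shows "\<exists>w. \<forall>v\<in>carrier_vec (dim_row A). (\<forall>i. w i \<in> carrier_vec (dim_row A)) \<and> comb A s (\<lambda>i. w i \<bullet> v) = v"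
proof -
  let ?S = "real_mat (cols_sub A s)"
  let ?d = "dim_row A"
  have sub: "s \<subseteq> {..<dim_col A}" and card: "card s = ?d" using s by (auto simp: col_basis_def)
  have fin: "finite s" using sub finite_subset by blast
  have S: "?S \<in> carrier_mat ?d ?d" 
    by (rule carrier_matI) (simp_all add: submatrix_cols[OF sub] card)
  have "det ?S \<noteq> 0" using vec_space.det_rank_iff[OF S] col_basis_iff_rank[OF sub card] s by blast
  then obtain W where W: "W \<in> carrier_mat ?d ?d" "?S * W = 1\<^sub>m ?d"
    using det_non_zero_imp_unit[OF S] S unfolding Units_def ring_mat_def by auto
  \<comment> \<open>The rows of the inverse matrix are the coordinate functionals; they are
    relabelled by column indices.\<close>
  define w where "w i = row W (the_inv_into {..<card s} (pick s) i)" for i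
  have wc: "w i \<in> carrier_vec ?d" for i
    unfolding w_def using row_carrier[of W] carrier_matD(2)[OF W(1)] by simp
  have "comb A s (\<lambda>i. w i \<bullet> v) = v" if v: "v \<in> carrier_vec ?d" for v
  proof -
    have "vec (card s) (\<lambda>k. w (pick s k) \<bullet> v) = W *\<^sub>v v"
    proof (rule eq_vecI)
      fix k assume "k < dim_vec (W *\<^sub>v v)"
      then have k: "k < card s" using W(1) card by simp
      have "the_inv_into {..<card s} (pick s) (pick s k) = k"
        using pick_bij[OF fin] k by (intro the_inv_into_f_f) (auto simp: bij_betw_def)
      then show "vec (card s) (\<lambda>k. w (pick s k) \<bullet> v) $ k = (W *\<^sub>v v) $ k"
        using k W(1) card by (simp add: w_def)
    qed (use W(1) card in simp)
    then have "comb A s (\<lambda>i. w i \<bullet> v) = ?S *\<^sub>v (W *\<^sub>v v)" using comb_cols_sub[OF sub, of "\<lambda>i. w i \<bullet> v"] by simp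
    also have "\<dots> = v" using S W v by (simp flip: assoc_mult_mat_vec)
    finally show ?thesis .
  qed
  then show ?thesis using wc by blast
qed

text \<open>For i in \<open>s\<close> this is the functional that reads off the coordinate at column
  i; for other i the choice is irrelevant, since \<open>comb\<close> ignores it.\<close>

definition dual_basis :: "int mat \<Rightarrow> nat set \<Rightarrow> nat \<Rightarrow> real vec" where
  "dual_basis A s = (SOME w. \<forall>v\<in>carrier_vec (dim_row A).
     (\<forall>i. w i \<in> carrier_vec (dim_row A)) \<and> comb A s (\<lambda>i. w i \<bullet> v) = v)"

lemma dual_basis:
  assumes "col_basis A s"
  shows dual_basis_carrier: "dual_basis A s i \<in> carrier_vec (dim_row A)"
    and comb_dual_basis: "v \<in> carrier_vec (dim_row A) \<Longrightarrow> comb A s (\<lambda>i. dual_basis A s i \<bullet> v) = v"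
proof -
  have *: "\<forall>v\<in>carrier_vec (dim_row A). (\<forall>i. dual_basis A s i \<in> carrier_vec (dim_row A)) \<and>
      comb A s (\<lambda>i. dual_basis A s i \<bullet> v) = v"
    unfolding dual_basis_def by (rule someI_ex[OF dual_basis_exists[OF assms]])
  show "dual_basis A s i \<in> carrier_vec (dim_row A)" using * zero_carrier_vec by blast
  show "v \<in> carrier_vec (dim_row A) \<Longrightarrow> comb A s (\<lambda>i. dual_basis A s i \<bullet> v) = v" using * by blast
qed

lemma comb_inj:
  assumes "col_basis A s" "comb A s x = comb A s y" "i \<in> s"
  shows "x i = y i"
proof -
  have "comb A s (\<lambda>j. x j - y j) = 0\<^sub>v (dim_row A)" using assms(2) by (simp add: comb_diff)
  then have "x i - y i = 0" using assms(1,3) unfolding col_basis_def by blast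
  then show ?thesis by simp
qed

lemma dual_basis_comb:
  assumes "col_basis A s" "i \<in> s"
  shows "dual_basis A s i \<bullet> comb A s x = x i"
  using comb_inj[OF assms(1) comb_dual_basis[OF assms(1), of "comb A s x"] assms(2)] by simp

lemma col_basis_finite: "col_basis A s \<Longrightarrow> finite s"
  unfolding col_basis_def using finite_subset by blast

lemma dual_basis_col:
  assumes "col_basis A s" "i \<in> s" "j \<in> s"
  shows "dual_basis A s i \<bullet> real_vec (col A j) = (if i = j then 1 else 0)"
proof -
  have j: "j < dim_col A" using assms by (auto simp: col_basis_def)
  have "real_vec (col A j) = comb A s (\<lambda>k. if k = j then 1 else 0)"
    using comb_delta[of s j A 1] assms j col_basis_finite by auto
  then show ?thesis using dual_basis_comb[OF assms(1,2)] by simp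
qed

text \<open>Passage from generators to inequalities: the dual basis vectors are inner normals of the
  facets of the simplicial cone.\<close>

lemma mem_col_cone_iff:
  assumes "col_basis A s"
  shows "v \<in> col_cone A s \<longleftrightarrow> v \<in> carrier_vec (dim_row A) \<and> (\<forall>i\<in>s. 0 \<le> dual_basis A s i \<bullet> v)"
proof
  assume "v \<in> col_cone A s"
  then show "v \<in> carrier_vec (dim_row A) \<and> (\<forall>i\<in>s. 0 \<le> dual_basis A s i \<bullet> v)"
    using dual_basis_comb[OF assms] by (auto simp: col_cone_def)
next
  assume v: "v \<in> carrier_vec (dim_row A) \<and> (\<forall>i\<in>s. 0 \<le> dual_basis A s i \<bullet> v)"
  then have "v = comb A s (\<lambda>i. dual_basis A s i \<bullet> v)" using comb_dual_basis[OF assms, of v] by simp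
  with v show "v \<in> col_cone A s" unfolding col_cone_def by blast
qed

lemma col_cone_carrier: "col_cone A s \<subseteq> carrier_vec (dim_row A)"
  by (auto simp: col_cone_def)

lemma col_cone_mono:
  assumes "finite t" "s \<subseteq> t"
  shows "col_cone A s \<subseteq> col_cone A t"
proof
  fix v assume "v \<in> col_cone A s"
  then obtain x where "\<forall>j\<in>s. 0 \<le> x j" "v = comb A s x" by (auto simp: col_cone_def)
  then have "v = comb A t (\<lambda>j. if j \<in> s then x j else 0)" "\<forall>j\<in>t. 0 \<le> (if j \<in> s then x j else 0)"
    using comb_superset[OF assms, of A x] by auto
  then show "v \<in> col_cone A t" unfolding col_cone_def by blast
qed

subsection \<open>Pivoting in chamber cells\<close>

lemma scalar_prod_comb:
  assumes "w \<in> carrier_vec (dim_row A)" "T \<subseteq> {..<dim_col A}"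
  shows "w \<bullet> comb A T y = (\<Sum>j\<in>T. y j * (w \<bullet> real_vec (col A j)))"
proof -
  have "w \<bullet> comb A T y = (\<Sum>i<dim_row A. \<Sum>j\<in>T. w $ i * (of_int (A $$ (i, j)) * y j))"
    by (simp add: scalar_prod_def atLeast0LessThan index_comb sum_distrib_left)
  also have "\<dots> = (\<Sum>j\<in>T. \<Sum>i<dim_row A. w $ i * (of_int (A $$ (i, j)) * y j))"
    by (rule sum.swap)
  also have "\<dots> = (\<Sum>j\<in>T. y j * (w \<bullet> real_vec (col A j)))"
  proof (rule sum.cong)
    fix j assume "j \<in> T"
    then have j: "j < dim_col A" using assms(2) by auto
    then show "(\<Sum>i<dim_row A. w $ i * (of_int (A $$ (i, j)) * y j)) = y j * (w \<bullet> real_vec (col A j))"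
      by (simp add: scalar_prod_def atLeast0LessThan sum_distrib_left mult.commute mult.left_commute)
  qed simp
  finally show ?thesis .
qed

text \<open>The update of a simplex tableau: the expansion of column \<open>j\<close> with
  coefficients \<open>u\<close> is solved for column \<open>i\<close> and substituted.\<close>

lemma comb_exchange:
  assumes s: "finite s" "i \<in> s" "j \<notin> s" and u: "u i \<noteq> 0" "comb A s u = real_vec (col A j)"
    and j: "j < dim_col A"
  shows "comb A (insert j (s - {i})) (\<lambda>k. if k = j then y i / u i else y k - y i / u i * u k)
    = comb A s y"
proof (rule eq_vecI)
  fix r assume "r < dim_vec (comb A s y)"
  then have r: "r < dim_row A" by simp
  let ?z = "\<lambda>k. y k - y i / u i * u k"
  have u_r: "(\<Sum>k\<in>s. of_int (A $$ (r, k)) * u k) = of_int (A $$ (r, j))"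
    using arg_cong[OF u(2), of "\<lambda>v. v $ r"] r j by (simp add: index_comb)
  have F1: "(\<Sum>k\<in>s. of_int (A $$ (r, k)) * ?z k) =
      (\<Sum>k\<in>s. of_int (A $$ (r, k)) * y k) - y i / u i * (\<Sum>k\<in>s. of_int (A $$ (r, k)) * u k)"
    by (simp add: right_diff_distrib sum_subtractf sum_distrib_left mult.left_commute)
  \<comment> \<open>The term at \<open>i\<close> is y i - y i = 0, so the leaving column may be
    dropped.\<close>
  have F2: "(\<Sum>k\<in>s. of_int (A $$ (r, k)) * ?z k) = (\<Sum>k\<in>s - {i}. of_int (A $$ (r, k)) * ?z k)"
    using s u(1) by (subst sum.remove[of s i]) auto
  have F3: "(\<Sum>k\<in>s - {i}. of_int (A $$ (r, k)) * ?z k)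
      = (\<Sum>k\<in>s - {i}. of_int (A $$ (r, k)) * (if k = j then y i / u i else ?z k))"
    using s(3) by (intro sum.cong) auto
  have "comb A (insert j (s - {i})) (\<lambda>k. if k = j then y i / u i else ?z k) $ r
      = of_int (A $$ (r, j)) * (y i / u i)
        + (\<Sum>k\<in>s - {i}. of_int (A $$ (r, k)) * (if k = j then y i / u i else ?z k))"
    using s r by (simp add: index_comb)
  also have "\<dots> = comb A s y $ r"
    unfolding F3[symmetric] F2[symmetric] F1 u_r using r by (simp add: index_comb)
  finally show "comb A (insert j (s - {i})) (\<lambda>k. if k = j then y i / u i else ?z k) $ r
      = comb A s y $ r" .
qed simp

lemma col_basis_exchange:
  assumes s: "col_basis A s" and ij: "i \<in> s" "j \<notin> s" "j < dim_col A"
    and u: "u i \<noteq> 0" "comb A s u = real_vec (col A j)"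
  shows "col_basis A (insert j (s - {i}))"
proof -
  have fin: "finite s" using col_basis_finite[OF s] .
  have "card (insert j (s - {i})) = card s"
    using fin ij by (simp add: card_Suc_Diff1 del: card_Diff_insert)
  moreover have "\<forall>k\<in>insert j (s - {i}). x k = 0"
    if x: "comb A (insert j (s - {i})) x = 0\<^sub>v (dim_row A)" for x
  proof -
    \<comment> \<open>The inverse substitution: expanding column \<open>j\<close> over
      \<open>s\<close> gives coefficients \<open>y\<close> with y i / u i = x j, from which
      \<open>comb_exchange\<close> recovers \<open>x\<close>.\<close>
    define y where "y k = (if k = i then 0 else x k) + x j * u k" for k
    have "comb A (insert j (s - {i})) x
        = comb A (insert j (s - {i})) (\<lambda>k. if k = j then y i / u i else y k - y i / u i * u k)"
      using u(1) ij by (intro comb_cong) (auto simp: y_def)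
    then have "comb A s y = 0\<^sub>v (dim_row A)" using comb_exchange[OF fin ij(1,2) u ij(3)] x by simp
    then have y: "y k = 0" if "k \<in> s" for k using s that by (auto simp: col_basis_def)
    then have "x j = 0" using ij(1) u(1) by (force simp: y_def)
    then show ?thesis using y by (force simp: y_def)
  qed
  ultimately show ?thesis using s ij(3) by (auto simp: col_basis_def)
qed

text \<open>Index sets replace cones because different bases may generate the same cone (parallel
  columns) and pivoting acts on the indices.\<close>

definition cell_bases :: "int mat \<Rightarrow> real vec \<Rightarrow> nat set set" where
  "cell_bases A b = {s. col_basis A s \<and> b \<in> col_cone A s}"

lemma finite_cell_bases: "finite (cell_bases A b)"
  by (rule finite_subset[of _ "Pow {..<dim_col A}"]) (auto simp: cell_bases_def col_basis_def)

lemma chamber_cell_eq: "chamber_cell A b = (\<Inter>s\<in>cell_bases A b. col_cone A s)"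
  by (auto simp: chamber_cell_def cell_bases_def simplicial_cones_eq)

text \<open>The hypothesis excludes the empty family, whose intersection would be the whole type,
  without regard to the vector dimension.\<close>

lemma mem_chamber_cell_iff:
  assumes "cell_bases A b \<noteq> {}"
  shows "v \<in> chamber_cell A b \<longleftrightarrow> v \<in> carrier_vec (dim_row A) \<and>
    (\<forall>s\<in>cell_bases A b. \<forall>i\<in>s. 0 \<le> dual_basis A s i \<bullet> v)"
proof -
  have "v \<in> chamber_cell A b \<longleftrightarrow> (\<forall>s\<in>cell_bases A b. v \<in> carrier_vec (dim_row A) \<and>
      (\<forall>i\<in>s. 0 \<le> dual_basis A s i \<bullet> v))"
    unfolding chamber_cell_eq using mem_col_cone_iff[of A _ v] by (auto simp: cell_bases_def)
  then show ?thesis using assms by blast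
qed

text \<open>In simplex terms, \<open>p\<close> is nondegenerate: none of its coordinates vanishes in
  any of the admissible bases.\<close>

definition cell_interior :: "int mat \<Rightarrow> real vec \<Rightarrow> real vec \<Rightarrow> bool" where
  "cell_interior A b p \<longleftrightarrow> p \<in> carrier_vec (dim_row A) \<and>
     (\<forall>s\<in>cell_bases A b. \<forall>i\<in>s. 0 < dual_basis A s i \<bullet> p)"

text \<open>A simplex pivoting argument: among the bases whose cone contains \<open>b\<close>, minimise the total
  weight that \<open>p\<close> puts on columns outside \<open>T\<close>. The ratio test is made on \<open>b\<close>, so that the new
  basis is again admissible, while strict decrease comes from \<open>p\<close>, which is never degenerate.\<close>

lemma cell_basis_within:
  assumes p: "cell_interior A b p" and T: "T \<subseteq> {..<dim_col A}" and pT: "p \<in> col_cone A T"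
    and ne: "cell_bases A b \<noteq> {}"
  shows "\<exists>s\<in>cell_bases A b. s \<subseteq> T"
proof -
  define V where "V s = (\<Sum>k\<in>s - T. dual_basis A s k \<bullet> p)" for s
  obtain s where s: "s \<in> cell_bases A b" and min: "\<And>t. t \<in> cell_bases A b \<Longrightarrow> V s \<le> V t"
    using ex_is_arg_min_if_finite[OF finite_cell_bases ne, of V] unfolding is_arg_min_linorder by blast
  have bas: "col_basis A s" and bs: "b \<in> col_cone A s" using s by (auto simp: cell_bases_def)
  have fin: "finite s" using col_basis_finite[OF bas] .
  have p_pos: "0 < dual_basis A s k \<bullet> p" if "k \<in> s" for k using p s that by (auto simp: cell_interior_def)
  have pc: "p \<in> carrier_vec (dim_row A)" using p by (simp add: cell_interior_def)
  have "s \<subseteq> T"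
  proof (rule ccontr)
    assume nsub: "\<not> s \<subseteq> T"
    obtain y where y: "\<forall>j\<in>T. 0 \<le> y j" "p = comb A T y" using pT by (auto simp: col_cone_def)
    define u where "u j k = dual_basis A s k \<bullet> real_vec (col A j)" for j k
    have "V s > 0" unfolding V_def using nsub fin p_pos by (intro sum_pos) auto
    moreover have "V s = (\<Sum>k\<in>s - T. \<Sum>j\<in>T. y j * u j k)"
      unfolding V_def u_def y(2) using dual_basis_carrier[OF bas] T by (simp add: scalar_prod_comb)
    then have "V s = (\<Sum>j\<in>T. y j * (\<Sum>k\<in>s - T. u j k))"
      by (subst (asm) sum.swap) (simp add: sum_distrib_left)
    \<comment> \<open>The positive number \<open>V s\<close> is a combination with nonnegative
      coefficients \<open>y j\<close> of the column totals outside \<open>T\<close>; some column of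
      \<open>T\<close> therefore has a positive total, and that column enters.\<close>
    ultimately have "\<exists>j\<in>T. \<not> y j * (\<Sum>k\<in>s - T. u j k) \<le> 0"
      using sum_nonpos[of T "\<lambda>j. y j * (\<Sum>k\<in>s - T. u j k)"] by force
    then obtain j where j: "j \<in> T" and uj: "(\<Sum>k\<in>s - T. u j k) > 0"
      using y(1) by (metis linorder_not_le mult_nonneg_nonpos)
    have jA: "j < dim_col A" using j T by auto
    have "j \<notin> s"
    proof
      assume "j \<in> s"
      then have "u j k = 0" if "k \<in> s - T" for k
        using dual_basis_col[OF bas, of k j] that j by (auto simp: u_def)
      then show False using uj by simp
    qed
    have comb_u: "comb A s (u j) = real_vec (col A j)"
      unfolding u_def using comb_dual_basis[OF bas] jA by simp
    define \<beta> where "\<beta> k = dual_basis A s k \<bullet> b" for k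
    define \<pi> where "\<pi> k = dual_basis A s k \<bullet> p" for k
    let ?K = "{k \<in> s. u j k > 0}"
    have "\<exists>k\<in>s - T. u j k > 0" using uj sum_nonpos[of "s - T" "u j"] by force
    then have "?K \<noteq> {}" by auto
    moreover have "finite ?K" using fin by simp
    ultimately obtain i where i: "i \<in> ?K" and ratio: "\<And>k. k \<in> ?K \<Longrightarrow> \<beta> i / u j i \<le> \<beta> k / u j k"
      using ex_is_arg_min_if_finite[of ?K "\<lambda>k. \<beta> k / u j k"] unfolding is_arg_min_linorder by blast
    then have is': "i \<in> s" and ui: "u j i > 0" by auto
    let ?s = "insert j (s - {i})"
    have bas': "col_basis A ?s" using col_basis_exchange[OF bas is' \<open>j \<notin> s\<close> jA _ comb_u] ui by simp
    have \<beta>0: "\<beta> k \<ge> 0" if "k \<in> s" for k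
      using that bs mem_col_cone_iff[OF bas] by (auto simp: \<beta>_def)
    have "b = comb A s \<beta>"
      unfolding \<beta>_def using comb_dual_basis[OF bas, of b] bs col_cone_carrier[of A s] by auto
    also have "\<dots> = comb A ?s (\<lambda>k. if k = j then \<beta> i / u j i else \<beta> k - \<beta> i / u j i * u j k)"
      using comb_exchange[OF fin is' \<open>j \<notin> s\<close> _ comb_u jA] ui by simp
    finally have b_eq: "b = \<dots>" .
    \<comment> \<open>For \<open>u j k\<close> \<le> 0 the coordinate does not decrease; for
      \<open>u j k\<close> > 0 minimality of the ratio at \<open>i\<close> keeps it
      nonnegative.\<close>
    have "0 \<le> (if k = j then \<beta> i / u j i else \<beta> k - \<beta> i / u j i * u j k)" if "k \<in> ?s" for k
    proof (cases "k = j \<or> u j k \<le> 0")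
      case True
      have \<theta>0: "0 \<le> \<beta> i / u j i" using \<beta>0[OF is'] ui by simp
      show ?thesis
      proof (cases "k = j")
        case True then show ?thesis using \<theta>0 by simp
      next
        case False
        then have "\<beta> i / u j i * u j k \<le> 0" using \<open>k = j \<or> u j k \<le> 0\<close> \<theta>0 mult_nonneg_nonpos by blast
        moreover have "0 \<le> \<beta> k" using \<beta>0[of k] that False by auto
        ultimately show ?thesis using False by simp
      qed
    next
      case False
      then have "\<beta> i / u j i \<le> \<beta> k / u j k" using ratio[of k] that by auto
      then show ?thesis using False by (auto simp: pos_le_divide_eq)
    qed
    then have "b \<in> col_cone A ?s" using b_eq unfolding col_cone_def by blast
    then have s': "?s \<in> cell_bases A b" using bas' by (simp add: cell_bases_def)
    have "p = comb A s \<pi>" unfolding \<pi>_def using comb_dual_basis[OF bas] pc by simp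
    also have "\<dots> = comb A ?s (\<lambda>k. if k = j then \<pi> i / u j i else \<pi> k - \<pi> i / u j i * u j k)"
      using comb_exchange[OF fin is' \<open>j \<notin> s\<close> _ comb_u jA] ui by simp
    finally have p_eq: "p = \<dots>" .
    have "V ?s = (\<Sum>k\<in>?s - T. if k = j then \<pi> i / u j i else \<pi> k - \<pi> i / u j i * u j k)"
      unfolding V_def using dual_basis_comb[OF bas'] by (subst (1) p_eq) (auto intro!: sum.cong)
    \<comment> \<open>The entering column \<open>j\<close> lies in \<open>T\<close> and carries no
      weight.\<close>
    also have "\<dots> = (\<Sum>k\<in>(s - T) - {i}. \<pi> k - \<pi> i / u j i * u j k)"
      using j \<open>j \<notin> s\<close> by (intro sum.cong) auto
    \<comment> \<open>The leaving index may be restored whether or not it lies in \<open>T\<close>: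
      if it occurs in the sum, its term is zero.\<close>
    also have "\<dots> = (\<Sum>k\<in>s - T. \<pi> k - \<pi> i / u j i * u j k)"
      using ui fin by (intro sum.mono_neutral_left) auto
    also have "\<dots> = V s - \<pi> i / u j i * (\<Sum>k\<in>s - T. u j k)"
      by (simp add: V_def \<pi>_def sum_subtractf sum_distrib_left)
    also have "\<dots> < V s" using p_pos[OF is'] ui uj by (simp add: \<pi>_def)
    finally show False using min[OF s'] by simp
  qed
  then show ?thesis using s by blast
qed

section \<open>Interior points of cells\<close>

lemma positive_on_finite_functionals:
  fixes C :: "real vec set"
  assumes "finite U" and C: "0\<^sub>v d \<in> C" "C \<subseteq> carrier_vec d" "\<And>x y. x \<in> C \<Longrightarrow> y \<in> C \<Longrightarrow> x + y \<in> C"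
    and U: "\<And>u. u \<in> U \<Longrightarrow> u \<in> carrier_vec d" "\<And>u x. u \<in> U \<Longrightarrow> x \<in> C \<Longrightarrow> 0 \<le> u \<bullet> x"
      "\<And>u. u \<in> U \<Longrightarrow> \<exists>x\<in>C. 0 < u \<bullet> x"
  shows "\<exists>p\<in>C. \<forall>u\<in>U. 0 < u \<bullet> p"
  using assms(1) U
proof (induction U)
  case empty then show ?case using C by auto
next
  case (insert u U)
  have "\<exists>p\<in>C. \<forall>v\<in>U. 0 < v \<bullet> p" using insert.prems by (intro insert.IH) auto
  then obtain p where p: "p \<in> C" "\<forall>v\<in>U. 0 < v \<bullet> p" by blast
  obtain x where x: "x \<in> C" "0 < u \<bullet> x" using insert.prems(3)[of u] by auto
  \<comment> \<open>Adding a witness for the new functional spoils nothing, because all functionals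
    are nonnegative on the cone.\<close>
  have "0 < v \<bullet> (p + x)" if "v \<in> insert u U" for v
  proof -
    have "v \<bullet> (p + x) = v \<bullet> p + v \<bullet> x"
      using insert.prems(1)[OF that] p(1) x(1) C(2) by (intro scalar_prod_add_distrib) auto
    moreover have "0 \<le> v \<bullet> p" "0 \<le> v \<bullet> x" using insert.prems(2) that p(1) x(1) by auto
    ultimately show ?thesis using that p(2) x(2) by fastforce
  qed
  then show ?case using C(3)[OF p(1) x(1)] by blast
qed

lemma chamber_cell_add:
  assumes "cell_bases A b \<noteq> {}" "x \<in> chamber_cell A b" "y \<in> chamber_cell A b"
  shows "x + y \<in> chamber_cell A b"
proof -
  have "dual_basis A s i \<bullet> (x + y) = dual_basis A s i \<bullet> x + dual_basis A s i \<bullet> y"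
    if "s \<in> cell_bases A b" for s i
    using that assms(2,3) dual_basis_carrier[of A s i] mem_chamber_cell_iff[OF assms(1)]
    by (intro scalar_prod_add_distrib) (auto simp: cell_bases_def)
  then show ?thesis using assms mem_chamber_cell_iff[OF assms(1)] by auto
qed

lemma chamber_cell_smult:
  assumes "cell_bases A b \<noteq> {}" "x \<in> chamber_cell A b" "0 \<le> c"
  shows "c \<cdot>\<^sub>v x \<in> chamber_cell A b"
proof -
  have "dual_basis A s i \<bullet> (c \<cdot>\<^sub>v x) = c * (dual_basis A s i \<bullet> x)"
    if "s \<in> cell_bases A b" for s i
    using that assms(2) dual_basis_carrier[of A s i] mem_chamber_cell_iff[OF assms(1)]
    by (intro scalar_prod_smult_right) (auto simp: cell_bases_def)
  then show ?thesis using assms mem_chamber_cell_iff[OF assms(1)] by auto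
qed

lemma zero_mem_chamber_cell: "cell_bases A b \<noteq> {} \<Longrightarrow> 0\<^sub>v (dim_row A) \<in> chamber_cell A b"
  using mem_chamber_cell_iff[of A b] dual_basis_carrier[of A] by (auto simp: cell_bases_def)

lemma chamber_cell_carrier: "cell_bases A b \<noteq> {} \<Longrightarrow> chamber_cell A b \<subseteq> carrier_vec (dim_row A)"
  using mem_chamber_cell_iff[of A b] by blast

text \<open>A coordinate functional vanishing on the full-dimensional cell would be zero, but it
  takes the value 1 on its own column.\<close>

lemma cell_interior_exists:
  assumes ne: "cell_bases A b \<noteq> {}" and dim: "cone_dim (dim_row A) (chamber_cell A b) = dim_row A"
  shows "\<exists>p\<in>chamber_cell A b. cell_interior A b p"
proof -
  let ?U = "\<Union>s\<in>cell_bases A b. dual_basis A s ` s"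
  have "\<exists>p\<in>chamber_cell A b. \<forall>u\<in>?U. 0 < u \<bullet> p"
  proof (rule positive_on_finite_functionals[where d = "dim_row A"])
    show "finite ?U" using finite_cell_bases col_basis_finite by (auto simp: cell_bases_def)
    show "0\<^sub>v (dim_row A) \<in> chamber_cell A b" by (rule zero_mem_chamber_cell[OF ne])
    show "chamber_cell A b \<subseteq> carrier_vec (dim_row A)" by (rule chamber_cell_carrier[OF ne])
    show "x + y \<in> chamber_cell A b" if "x \<in> chamber_cell A b" "y \<in> chamber_cell A b" for x y
      using chamber_cell_add[OF ne that] .
    fix u assume "u \<in> ?U"
    then obtain s i where si: "s \<in> cell_bases A b" "i \<in> s" "u = dual_basis A s i" by blast
    then have bas: "col_basis A s" by (simp add: cell_bases_def)
    show u: "u \<in> carrier_vec (dim_row A)" using si(3) dual_basis_carrier[OF bas] by simp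
    show nonneg: "0 \<le> u \<bullet> x" if "x \<in> chamber_cell A b" for x
      using that si mem_chamber_cell_iff[OF ne] by auto
    show "\<exists>x\<in>chamber_cell A b. 0 < u \<bullet> x"
    proof (rule ccontr)
      assume "\<not> (\<exists>x\<in>chamber_cell A b. 0 < u \<bullet> x)"
      then have "u \<bullet> x = 0" if "x \<in> chamber_cell A b" for x
        using nonneg[OF that] that by force
      then have "u = 0\<^sub>v (dim_row A)"
        using orthogonal_to_full_dim[OF chamber_cell_carrier[OF ne] dim u] by blast
      moreover have "u \<bullet> real_vec (col A i) = 1" using dual_basis_col[OF bas si(2,2)] si(3) by simp
      moreover have "real_vec (col A i) \<in> carrier_vec (dim_row A)" by simp
      ultimately show False by (metis scalar_prod_left_zero zero_neq_one)
    qed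
  qed
  then obtain p where "p \<in> chamber_cell A b" "\<forall>u\<in>?U. 0 < u \<bullet> p" by blast
  then show ?thesis using chamber_cell_carrier[OF ne] unfolding cell_interior_def by blast
qed

text \<open>The chamber complex also contains proper faces of cells; full dimension forces the face
  normal to be zero and leaves only the cell itself. The cone \<sigma> around \<gamma> supplies a
  basis whose cone contains \<open>b\<close>.\<close>

lemma chamber_is_cell:
  assumes \<gamma>: "\<gamma> \<in> chambers A" and \<sigma>: "\<sigma> \<in> simplicial_cones A" "\<gamma> \<subseteq> \<sigma>"
  obtains b where "b \<in> pos_cone A" "cell_bases A b \<noteq> {}" "\<gamma> = chamber_cell A b"
    "cone_dim (dim_row A) \<gamma> = dim_row A"
proof -
  let ?d = "dim_row A"
  obtain b u where b: "b \<in> pos_cone A" and u: "u \<in> carrier_vec ?d"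
    and eq: "\<gamma> = {x \<in> chamber_cell A b. u \<bullet> x = 0}" and dim: "cone_dim ?d \<gamma> = ?d"
    using \<gamma> by (auto simp: chambers_def chamber_complex_def is_face_def)
  obtain s where s: "col_basis A s" "\<sigma> = col_cone A s" using \<sigma>(1) by (auto simp: simplicial_cones_eq)
  have "\<gamma> \<subseteq> carrier_vec ?d" using \<sigma>(2) s(2) col_cone_carrier by blast
  then have u0: "u = 0\<^sub>v ?d" using orthogonal_to_full_dim[OF _ dim u] eq by blast
  have bd: "b \<in> carrier_vec ?d" using b col_cone_carrier by (auto simp: pos_cone_eq_col_cone)
  have "b \<in> chamber_cell A b" by (auto simp: chamber_cell_def)
  then have "b \<in> \<gamma>" using eq u0 bd by simp
  then have ne: "cell_bases A b \<noteq> {}" using s \<sigma>(2) by (auto simp: cell_bases_def)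
  have "\<gamma> = chamber_cell A b" using eq u0 chamber_cell_carrier[OF ne] by auto
  then show thesis using that b ne dim by blast
qed

lemma cell_diff:
  assumes ne: "cell_bases A b \<noteq> {}" and p: "cell_interior A b p" "p \<in> chamber_cell A b"
    and v: "v \<in> carrier_vec (dim_row A)"
  shows "\<exists>x\<in>chamber_cell A b. \<exists>y\<in>chamber_cell A b. v = x - y"
proof -
  let ?U = "\<Union>s\<in>cell_bases A b. dual_basis A s ` s"
  \<comment> \<open>The sum bounds each single ratio, so adding \<open>K \<cdot>\<^sub>v p\<close>
    outweighs \<open>v\<close> on every facet functional at once.\<close>
  define K where "K = (\<Sum>u\<in>?U. \<bar>u \<bullet> v\<bar> / (u \<bullet> p))"
  have fin: "finite ?U" using finite_cell_bases col_basis_finite by (auto simp: cell_bases_def)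
  have pc: "p \<in> carrier_vec (dim_row A)" using p by (simp add: cell_interior_def)
  have pos: "0 < u \<bullet> p" if "u \<in> ?U" for u using that p(1) by (auto simp: cell_interior_def)
  have K0: "0 \<le> K" unfolding K_def using pos by (intro sum_nonneg) (simp add: less_imp_le)
  have "v + K \<cdot>\<^sub>v p \<in> chamber_cell A b"
    unfolding mem_chamber_cell_iff[OF ne]
  proof (intro conjI ballI)
    show "v + K \<cdot>\<^sub>v p \<in> carrier_vec (dim_row A)" using v pc by simp
    fix s i assume si: "s \<in> cell_bases A b" "i \<in> s"
    let ?u = "dual_basis A s i"
    have uU: "?u \<in> ?U" using si by blast
    have uc: "?u \<in> carrier_vec (dim_row A)" using si dual_basis_carrier by (auto simp: cell_bases_def)
    have "\<bar>?u \<bullet> v\<bar> / (?u \<bullet> p) \<le> K"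
      unfolding K_def using pos fin uU by (intro member_le_sum) (auto simp: less_imp_le)
    then have "\<bar>?u \<bullet> v\<bar> \<le> K * (?u \<bullet> p)" using pos[OF uU] by (simp add: pos_divide_le_eq)
    then show "0 \<le> ?u \<bullet> (v + K \<cdot>\<^sub>v p)"
      using uc v pc by (simp add: scalar_prod_add_distrib[of _ "dim_row A"])
  qed
  moreover have "K \<cdot>\<^sub>v p \<in> chamber_cell A b" using chamber_cell_smult[OF ne p(2) K0] .
  moreover have "v = v + K \<cdot>\<^sub>v p - K \<cdot>\<^sub>v p" using v pc by auto
  ultimately show ?thesis by blast
qed

subsection \<open>Projection along external columns\<close>

lemma real_mult_mat_vec:
  assumes "x \<in> carrier_vec (dim_col A)"
  shows "real_vec (A *\<^sub>v x) = real_mat A *\<^sub>v real_vec x"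
  using of_int_hom.mult_mat_vec_hom[of A "dim_row A" "dim_col A" x] assms by auto

lemma real_mult_mat_vec_comb:
  assumes "x \<in> carrier_vec (dim_col A)"
  shows "real_vec (A *\<^sub>v x) = comb A {..<dim_col A} (\<lambda>j. of_int (x $ j))"
  using assms by (subst real_mult_mat_vec[OF assms], subst comb_eq_mat_mult) (auto intro: comb_cong)

lemma real_vec_eq_iff: "real_vec u = real_vec v \<longleftrightarrow> u = v"
  using of_int_hom.vec_hom_inj[of u v] by auto

text \<open>Otherwise the cone over \<open>s\<close> would be part of the cone over all other
  columns. Consequently the external columns of \<gamma> belong to every basis whose cone contains
  \<gamma>.\<close>

lemma external_column_in_basis:
  assumes j: "external_column A j" and s: "s \<subseteq> {..<dim_col A}" "real_vec (col A j) \<in> col_cone A s"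
  shows "j \<in> s"
proof (rule ccontr)
  assume "j \<notin> s"
  then have sub: "s \<subseteq> {..<dim_col A} - {j}" using s by auto
  have "real_vec (col A j) \<in> col_cone A ({..<dim_col A} - {j})"
    using col_cone_mono[OF _ sub] s(2) by auto
  then show False using j pos_cone_cols_sub[of "{..<dim_col A} - {j}" A] by (auto simp: external_column_def)
qed

text \<open>\<open>P\<close> abstracts the last \<open>d - l\<close> rows of the dual ray matrix.
  What is retained: it kills the first \<open>l\<close> columns, its real kernel is spanned by them,
  and each coordinate direction is hit by a column up to a positive integer factor \<open>D\<close>.
  This factor need not be 1, so integral vectors need not have lattice preimages.\<close>

locale chamber_projection =
  fixes A P B :: "int mat" and d n l :: nat and \<gamma> :: "real vec set" and b0 :: "real vec"
  assumes A: "A \<in> carrier_mat d n"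
    and ne: "cell_bases A b0 \<noteq> {}"
    and \<gamma>: "\<gamma> = chamber_cell A b0"
    and b0: "b0 \<in> pos_cone A"
    and dim: "cone_dim d \<gamma> = d"
    and ext: "{j. external_column A j \<and> real_vec (col A j) \<in> \<gamma>} = {..<l}"
    and sat: "saturated_in (cols_sub A {..<l}) A"
    and P: "P \<in> carrier_mat (d - l) d"
    and P_col: "\<And>j. j < l \<Longrightarrow> P *\<^sub>v col A j = 0\<^sub>v (d - l)"
    and P_ker: "\<And>v. v \<in> carrier_vec d \<Longrightarrow> real_mat P *\<^sub>v v = 0\<^sub>v (d - l) \<Longrightarrow> \<exists>x. v = comb A {..<l} x"
    and P_unit: "\<And>k. k < d - l \<Longrightarrow> \<exists>j<n. \<exists>D>0. P *\<^sub>v col A j = D \<cdot>\<^sub>v unit_vec (d - l) k"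
    and B: "B = mat (d - l) (n - l) (\<lambda>(i, j). (P *\<^sub>v col A (l + j)) $ i)"
begin

lemma dims [simp]: "dim_row A = d" "dim_col A = n" "dim_row B = d - l" "dim_col B = n - l"
    "dim_row P = d - l" "dim_col P = d"
  using A P B by auto

lemma comb_carrier_AB [simp]:
  "comb A s x \<in> carrier_vec d" "comb B t y \<in> carrier_vec (d - l)"
  using comb_carrier[of A] comb_carrier[of B] by simp_all

lemma proj_col_index:
  assumes "j < n" "i < d - l"
  shows "of_int ((P *\<^sub>v col A j) $ i) = (\<Sum>r<d. of_int (P $$ (i, r)) * (of_int (A $$ (r, j)) :: real))"
  using assms by (simp add: scalar_prod_def atLeast0LessThan)

abbreviation proj :: "real vec \<Rightarrow> real vec" where
  "proj v \<equiv> real_mat P *\<^sub>v v"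

lemma \<gamma>_carrier: "\<gamma> \<subseteq> carrier_vec d"
  using chamber_cell_carrier[OF ne] \<gamma> by simp

lemma col_in_\<gamma>: "j < l \<Longrightarrow> real_vec (col A j) \<in> \<gamma>"
  and l_external: "j < l \<Longrightarrow> external_column A j"
  using ext by auto

lemma l_le_n: "l \<le> n"
proof (cases l)
  case (Suc k)
  then have "external_column A k" using l_external by simp
  then show ?thesis using Suc by (simp add: external_column_def)
qed simp

lemma cell_basesD:
  assumes "s \<in> cell_bases A b0"
  shows "col_basis A s" "s \<subseteq> {..<n}" "card s = d" "{..<l} \<subseteq> s" "\<gamma> \<subseteq> col_cone A s"
proof -
  show bas: "col_basis A s" using assms by (simp add: cell_bases_def)
  show sub: "s \<subseteq> {..<n}" and "card s = d" using bas by (auto simp: col_basis_def)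
  show \<gamma>s: "\<gamma> \<subseteq> col_cone A s" unfolding \<gamma> chamber_cell_eq using assms by auto
  show "{..<l} \<subseteq> s"
  proof
    fix j assume "j \<in> {..<l}"
    then have "external_column A j" "real_vec (col A j) \<in> col_cone A s"
      using l_external col_in_\<gamma> \<gamma>s by auto
    then show "j \<in> s" using external_column_in_basis[of A j s] sub by simp
  qed
qed

lemma l_le_d: "l \<le> d"
proof -
  obtain s where s: "s \<in> cell_bases A b0" using ne by blast
  have "card {..<l} \<le> card s"
    by (rule card_mono[OF col_basis_finite[OF cell_basesD(1)[OF s]] cell_basesD(4)[OF s]])
  then show ?thesis using cell_basesD(3)[OF s] by simp
qed

lemma first_columns_indep:
  assumes "comb A {..<l} x = comb A {..<l} y" "j < l"
  shows "x j = y j"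
proof -
  obtain s where s: "s \<in> cell_bases A b0" using ne by blast
  note D = cell_basesD[OF s]
  have "comb A s (\<lambda>j. if j \<in> {..<l} then x j else 0) = comb A s (\<lambda>j. if j \<in> {..<l} then y j else 0)"
    using comb_superset[OF col_basis_finite[OF D(1)] D(4)] assms(1) by simp
  from comb_inj[OF D(1) this, of j] show ?thesis using assms(2) D(4) by auto
qed

text \<open>Columns below \<open>l\<close> project to zero and column l + j projects to column j of
  \<open>B\<close>; projecting therefore forgets the first coefficients and shifts the rest.\<close>

lemma proj_comb:
  assumes s: "s \<subseteq> {..<n}"
  shows "proj (comb A s x) = comb B {j. l + j \<in> s} (\<lambda>j. x (l + j))"
proof (rule eq_vecI)
  fix i assume "i < dim_vec (comb B {j. l + j \<in> s} (\<lambda>j. x (l + j)))"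
  then have i: "i < d - l" by simp
  have fin: "finite s" using s finite_subset by blast
  let ?q = "\<lambda>j. of_int ((P *\<^sub>v col A j) $ i) * x j"
  have "proj (comb A s x) $ i = (\<Sum>r<d. \<Sum>j\<in>s. of_int (P $$ (i, r)) * (of_int (A $$ (r, j)) * x j))"
    using i by (simp add: scalar_prod_def atLeast0LessThan index_comb sum_distrib_left)
  also have "\<dots> = (\<Sum>j\<in>s. \<Sum>r<d. of_int (P $$ (i, r)) * (of_int (A $$ (r, j)) * x j))"
    by (rule sum.swap)
  also have "\<dots> = (\<Sum>j\<in>s. ?q j)"
  proof (rule sum.cong)
    fix j assume "j \<in> s"
    then have "j < n" using s by auto
    then show "(\<Sum>r<d. of_int (P $$ (i, r)) * (of_int (A $$ (r, j)) * x j)) = ?q j"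
      by (simp only: proj_col_index[OF _ i] sum_distrib_right mult.assoc)
  qed simp
  also have "\<dots> = (\<Sum>j\<in>(+) l ` {j. l + j \<in> s}. ?q j)"
  proof (rule sum.mono_neutral_right[OF fin])
    show "\<forall>j\<in>s - (+) l ` {j. l + j \<in> s}. ?q j = 0"
    proof
      fix j assume "j \<in> s - (+) l ` {j. l + j \<in> s}"
      then have "j < l" by (metis (mono_tags, lifting) DiffE image_eqI le_add_diff_inverse linorder_not_le mem_Collect_eq)
      then show "?q j = 0" using P_col[of j] i by simp
    qed
  qed auto
  also have "\<dots> = (\<Sum>j\<in>{j. l + j \<in> s}. ?q (l + j))"
    by (subst sum.reindex) (auto simp: inj_on_def)
  also have "\<dots> = comb B {j. l + j \<in> s} (\<lambda>j. x (l + j)) $ i"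
  proof -
    have "of_int ((P *\<^sub>v col A (l + j)) $ i) = (of_int (B $$ (i, j)) :: real)" if "l + j \<in> s" for j
    proof -
      have "j < n - l" using that s by auto
      then show ?thesis using i by (simp add: B)
    qed
    then show ?thesis using i by (auto simp: index_comb intro!: sum.cong)
  qed
  finally show "proj (comb A s x) $ i = comb B {j. l + j \<in> s} (\<lambda>j. x (l + j)) $ i" .
qed simp

lemma proj_comb_first: "proj (comb A {..<l} x) = 0\<^sub>v (d - l)"
proof -
  have "proj (comb A {..<l} x) = comb B {} (\<lambda>j. x (l + j))"
    using proj_comb[of "{..<l}" x] l_le_n by auto
  then show ?thesis by (auto simp: comb_def)
qed

lemma proj_add: "v \<in> carrier_vec d \<Longrightarrow> w \<in> carrier_vec d \<Longrightarrow> proj (v + w) = proj v + proj w"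
  by (rule mult_add_distrib_mat_vec[of _ "d - l" d]) auto

lemma proj_diff: "v \<in> carrier_vec d \<Longrightarrow> w \<in> carrier_vec d \<Longrightarrow> proj (v - w) = proj v - proj w"
  by (rule mult_minus_distrib_mat_vec[of _ "d - l" d]) auto

lemma interior:
  obtains p where "p \<in> \<gamma>" "cell_interior A b0 p"
  using cell_interior_exists[OF ne] dim \<gamma> by auto

text \<open>If \<open>x i\<close> were negative, then cancelling all negative coefficients by adding columns of
  \<open>\<gamma>\<close> would give an interior point of the cell in the cone of the columns other than \<open>i\<close>, hence,
  by pivoting, a simplicial cone that contains \<open>\<gamma>\<close> and avoids the external column \<open>i\<close>.\<close>

lemma coeff_nonneg:
  assumes v: "v \<in> \<gamma>" "v = comb A {..<n} x" and x: "\<And>j. l \<le> j \<Longrightarrow> j < n \<Longrightarrow> 0 \<le> x j" and i: "i < l"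
  shows "0 \<le> x i"
proof (rule ccontr)
  assume "\<not> 0 \<le> x i"
  then have neg: "x i < 0" by simp
  have i_n: "i < n" using i l_le_n by simp
  obtain p0 where p0: "p0 \<in> \<gamma>" "cell_interior A b0 p0" by (rule interior)
  obtain s0 where s0: "s0 \<in> cell_bases A b0" using ne by blast
  have "p0 \<in> col_cone A {..<n}"
    using cell_basesD(2,5)[OF s0] p0(1) col_cone_mono[of "{..<n}" s0 A] by auto
  then obtain \<mu> where \<mu>: "\<forall>j\<in>{..<n}. 0 \<le> \<mu> j" "p0 = comb A {..<n} \<mu>" by (auto simp: col_cone_def)
  \<comment> \<open>Chosen so that \<epsilon> (\<mu> i + 1) is half of - x i: the perturbed
    coefficient \<open>z i\<close> remains negative, and the summand 1 keeps the denominator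
    positive when \<mu> i = 0.\<close>
  define \<epsilon> where "\<epsilon> = - x i / (2 * (\<mu> i + 1))"
  have \<mu>i: "0 \<le> \<mu> i" using \<mu>(1) i_n by simp
  then have \<epsilon>: "\<epsilon> > 0" using neg by (simp add: \<epsilon>_def divide_neg_pos)
  define z where "z j = x j + \<epsilon> * \<mu> j" for j
  have "\<epsilon> * (2 * (\<mu> i + 1)) = - x i" using \<mu>i by (simp add: \<epsilon>_def)
  then have "2 * (\<epsilon> * \<mu> i) + 2 * \<epsilon> = - x i" by (simp add: algebra_simps)
  then have zi: "z i < 0" unfolding z_def using \<epsilon> neg \<mu>i mult_nonneg_nonneg[of \<epsilon> "\<mu> i"] by linarith
  have z_pos: "0 \<le> z j" if "l \<le> j" "j < n" for j
    unfolding z_def using x[OF that] \<epsilon> \<mu>(1) that by simp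
  \<comment> \<open>These amounts cancel exactly the negative parts of \<open>z\<close>, which occur
    only below \<open>l\<close>; in particular the coefficient at \<open>i\<close> becomes
    0.\<close>
  define c where "c j = max (- z j) 0" for j
  \<comment> \<open>Every summand lies in \<gamma>, and the multiple of \<open>p0\<close> makes the
    sum interior.\<close>
  define p where "p = v + \<epsilon> \<cdot>\<^sub>v p0 + comb A {..<l} c"
  let ?T = "{..<n} - {i}"
  have vc: "v \<in> carrier_vec d" "p0 \<in> carrier_vec d" using v(1) p0(1) \<gamma>_carrier by auto
  have "p = comb A {..<n} z + comb A {..<n} (\<lambda>j. if j \<in> {..<l} then c j else 0)"
    unfolding p_def z_def comb_add comb_smult using comb_superset[of "{..<n}" "{..<l}" A c] l_le_n v(2) \<mu>(2) by simp
  also have "\<dots> = comb A {..<n} (\<lambda>j. z j + (if j \<in> {..<l} then c j else 0))"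
    by (simp add: comb_add)
  also have "\<dots> = comb A {..<n} (\<lambda>j. if j \<in> ?T then max (z j) 0 else 0)"
  proof (rule comb_cong)
    fix j assume "j \<in> {..<n}"
    then show "z j + (if j \<in> {..<l} then c j else 0) = (if j \<in> ?T then max (z j) 0 else 0)"
      using zi z_pos[of j] i by (cases "j < l") (auto simp: c_def max_def not_less)
  qed
  also have "\<dots> = comb A ?T (\<lambda>j. max (z j) 0)" by (rule comb_superset) auto
  finally have pT: "p \<in> col_cone A ?T" by (auto simp: col_cone_def)
  have "cell_interior A b0 p"
    unfolding cell_interior_def
  proof (intro conjI ballI)
    show "p \<in> carrier_vec (dim_row A)" using vc by (simp add: p_def)
    fix s k assume s: "s \<in> cell_bases A b0" and k: "k \<in> s"
    let ?w = "dual_basis A s k"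
    have w: "?w \<in> carrier_vec d" using dual_basis_carrier[OF cell_basesD(1)[OF s]] by simp
    have wg: "0 \<le> ?w \<bullet> y" if "y \<in> \<gamma>" for y
      using that s k mem_chamber_cell_iff[OF ne] \<gamma> by auto
    have "?w \<bullet> p = ?w \<bullet> v + \<epsilon> * (?w \<bullet> p0) + ?w \<bullet> comb A {..<l} c"
      unfolding p_def using w vc comb_carrier[of A "{..<l}" c] by (simp add: scalar_prod_add_distrib[of _ d])
    moreover have "?w \<bullet> comb A {..<l} c = (\<Sum>j<l. c j * (?w \<bullet> real_vec (col A j)))"
      using w l_le_n by (intro scalar_prod_comb) auto
    moreover have "0 \<le> (\<Sum>j<l. c j * (?w \<bullet> real_vec (col A j)))"
      using wg col_in_\<gamma> by (intro sum_nonneg mult_nonneg_nonneg) (auto simp: c_def)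
    moreover have "0 < \<epsilon> * (?w \<bullet> p0)" using \<epsilon> p0(2) s k by (simp add: cell_interior_def)
    ultimately show "0 < ?w \<bullet> p" using wg[OF v(1)] by linarith
  qed
  then obtain s where s: "s \<in> cell_bases A b0" "s \<subseteq> ?T"
    using cell_basis_within[OF _ _ pT ne] by auto
  then have "real_vec (col A i) \<in> col_cone A s" using cell_basesD(5) col_in_\<gamma>[OF i] by blast
  then show False using external_column_in_basis[OF l_external[OF i]] cell_basesD(2)[OF s(1)] s(2) by auto
qed

lemma comb_shift:
  assumes s: "s \<subseteq> {..<n}" "{..<l} \<subseteq> s"
  shows "comb A s (\<lambda>j. if j < l then x j else y (j - l))
    = comb A {..<l} x + comb A (s - {..<l}) (\<lambda>j. y (j - l))"
proof -
  have "finite s" using s finite_subset by blast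
  moreover have "s = {..<l} \<union> (s - {..<l})" using s by auto
  ultimately have "comb A s (\<lambda>j. if j < l then x j else y (j - l))
     = comb A {..<l} (\<lambda>j. if j < l then x j else y (j - l))
       + comb A (s - {..<l}) (\<lambda>j. if j < l then x j else y (j - l))"
    by (metis (no_types, lifting) Diff_disjoint comb_Un finite_Diff finite_lessThan)
  also have "comb A {..<l} (\<lambda>j. if j < l then x j else y (j - l)) = comb A {..<l} x"
    by (rule comb_cong) simp
  also have "comb A (s - {..<l}) (\<lambda>j. if j < l then x j else y (j - l)) = comb A (s - {..<l}) (\<lambda>j. y (j - l))"
    by (rule comb_cong) simp
  finally show ?thesis .
qed

text \<open>Using the coefficients of \<open>B\<close> unchanged on the shifted columns of
  \<open>A\<close> leaves an error in the kernel of the projection, hence a combination of the first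
  \<open>l\<close> columns. Nothing is claimed about the signs of those new coefficients; that is
  the task of \<open>coeff_nonneg\<close>.\<close>

lemma lift_comb:
  assumes s: "s \<subseteq> {..<n}" "{..<l} \<subseteq> s" and v: "v \<in> carrier_vec d"
    and pv: "proj v = comb B {j. l + j \<in> s} y"
  shows "\<exists>x. v = comb A s (\<lambda>j. if j < l then x j else y (j - l))"
proof -
  let ?r = "comb A (s - {..<l}) (\<lambda>j. y (j - l))"
  have r: "?r \<in> carrier_vec d" using comb_carrier[of A] by simp
  have "proj ?r = comb B {j. l + j \<in> s - {..<l}} (\<lambda>j. y (l + j - l))"
    using s by (intro proj_comb) auto
  also have "{j. l + j \<in> s - {..<l}} = {j. l + j \<in> s}" by auto
  finally have "proj (v - ?r) = 0\<^sub>v (d - l)"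
    using pv proj_diff[OF v r] minus_cancel_vec[OF comb_carrier[of B]] by simp
  then obtain x where x: "v - ?r = comb A {..<l} x" using P_ker[of "v - ?r"] v r by auto
  have "v = (v - ?r) + ?r" using v r by (intro eq_vecI) auto
  then have "v = comb A {..<l} x + ?r" unfolding x .
  then show ?thesis using comb_shift[OF s] by metis
qed

section \<open>Correspondence between the cell bases of A and B\<close>

lemma cell_bases_A_to_B:
  assumes s: "s \<in> cell_bases A b0"
  shows "{j. l + j \<in> s} \<in> cell_bases B (proj b0)"
proof -
  let ?t = "{j. l + j \<in> s}"
  note D = cell_basesD[OF s]
  have fin: "finite s" using col_basis_finite[OF D(1)] .
  have t: "?t \<subseteq> {..<n - l}" using D(2) by auto
  have "s = {..<l} \<union> (+) l ` ?t" using D(4) by (auto simp: image_iff) (metis le_add_diff_inverse not_le)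
  then have "card s = card ({..<l} \<union> (+) l ` ?t)" by simp
  also have "\<dots> = card {..<l} + card ((+) l ` ?t)"
    using t finite_subset by (intro card_Un_disjoint) auto
  also have "\<dots> = l + card ?t" by (simp add: card_image)
  finally have card: "card ?t = d - l" using D(3) by simp
  have "\<forall>j\<in>?t. y j = 0" if y: "comb B ?t y = 0\<^sub>v (d - l)" for y
  proof -
    \<comment> \<open>A linear relation among projected columns is a representation of proj 0, so it
      lifts to a relation among the independent columns of \<open>s\<close>.\<close>
    have "proj (0\<^sub>v d) = comb B ?t y" unfolding y using P by (intro eq_vecI) auto
    then obtain x where "comb A s (\<lambda>j. if j < l then x j else y (j - l)) = 0\<^sub>v d"
      using lift_comb[OF D(2,4), of "0\<^sub>v d" y] by auto
    then have *: "\<forall>j\<in>s. (if j < l then x j else y (j - l)) = 0"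
      using D(1) unfolding col_basis_def dims by blast
    show ?thesis
    proof
      fix j assume "j \<in> ?t"
      then have "(if l + j < l then x (l + j) else y (l + j - l)) = 0" using * by blast
      then show "y j = 0" by simp
    qed
  qed
  then have "col_basis B ?t" using t card by (auto simp: col_basis_def)
  moreover obtain x where x: "\<forall>j\<in>s. 0 \<le> x j" "b0 = comb A s x"
    using s by (auto simp: cell_bases_def col_cone_def)
  have "proj b0 = comb B ?t (\<lambda>j. x (l + j))" unfolding x(2) by (rule proj_comb[OF D(2)])
  then have "proj b0 \<in> col_cone B ?t" using x(1) unfolding col_cone_def by blast
  ultimately show ?thesis by (simp add: cell_bases_def)
qed

lemma b0_in_\<gamma>: "b0 \<in> \<gamma>"
  using \<gamma> by (auto simp: chamber_cell_def)

lemma b0_carrier: "b0 \<in> carrier_vec d"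
  using b0_in_\<gamma> \<gamma>_carrier by blast

text \<open>Independence again comes from the projection, but membership of \<open>b0\<close> needs
  signs: its lifted coefficients on the first \<open>l\<close> columns could be negative, were it
  not for \<open>coeff_nonneg\<close>.\<close>

lemma cell_bases_B_to_A:
  assumes t: "t \<in> cell_bases B (proj b0)"
  defines "s \<equiv> {..<l} \<union> (+) l ` t"
  shows "s \<in> cell_bases A b0" "{j. l + j \<in> s} = t"
proof -
  have basB: "col_basis B t" using t by (simp add: cell_bases_def)
  have tsub: "t \<subseteq> {..<n - l}" and tcard: "card t = d - l" using basB by (auto simp: col_basis_def)
  have fint: "finite t" using col_basis_finite[OF basB] .
  have s: "s \<subseteq> {..<n}" "{..<l} \<subseteq> s" using tsub l_le_n unfolding s_def by auto
  have fin: "finite s" using s(1) finite_subset by blast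
  show eq: "{j. l + j \<in> s} = t" unfolding s_def by auto
  have "card s = card {..<l} + card ((+) l ` t)"
    unfolding s_def using fint by (intro card_Un_disjoint) auto
  then have card: "card s = d" using tcard l_le_d by (simp add: card_image)
  have "\<forall>j\<in>s. x j = 0" if x: "comb A s x = 0\<^sub>v d" for x
  proof -
    have "comb B t (\<lambda>j. x (l + j)) = proj (0\<^sub>v d)" using proj_comb[OF s(1), of x] x eq by simp
    also have "\<dots> = 0\<^sub>v (d - l)" using P by (intro eq_vecI) auto
    finally have xt: "\<forall>j\<in>t. x (l + j) = 0" using basB unfolding col_basis_def dims by blast
    have "comb A {..<l} x = comb A s (\<lambda>j. if j \<in> {..<l} then x j else 0)"
      using comb_superset[OF fin s(2), of A x] by simp
    also have "\<dots> = comb A s x" using xt unfolding s_def by (intro comb_cong) auto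
    also have "\<dots> = comb A {..<l} (\<lambda>j. 0)" unfolding x by (auto simp: comb_def)
    finally have "\<forall>j<l. x j = 0" using first_columns_indep[of x "\<lambda>j. 0"] by blast
    then show ?thesis using xt unfolding s_def by auto
  qed
  then have basA: "col_basis A s" using s card by (auto simp: col_basis_def)
  obtain y where y: "\<forall>j\<in>t. 0 \<le> y j" "proj b0 = comb B t y"
    using t by (auto simp: cell_bases_def col_cone_def)
  obtain x where x: "b0 = comb A s (\<lambda>j. if j < l then x j else y (j - l))"
    using lift_comb[OF s b0_carrier, of y] y(2) eq by auto
  define z where "z j = (if j < l then x j else y (j - l))" for j
  have zs: "0 \<le> z j" if "j \<in> s" "l \<le> j" for j using that y(1) by (auto simp: z_def s_def)
  \<comment> \<open>Extension by zero to all columns, the form of representation to which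
    \<open>coeff_nonneg\<close> applies.\<close>
  have "b0 = comb A {..<n} (\<lambda>j. if j \<in> s then z j else 0)"
    using comb_superset[of "{..<n}" s A z] s(1) x unfolding z_def[symmetric] by simp
  then have "0 \<le> z j" if "j < l" for j
    using coeff_nonneg[OF b0_in_\<gamma>, of "\<lambda>j. if j \<in> s then z j else 0" j] zs that s(2) by auto
  then have "\<forall>j\<in>s. 0 \<le> z j" using zs by (metis linorder_not_le)
  moreover have "b0 = comb A s z" unfolding z_def by (rule x)
  ultimately have "b0 \<in> col_cone A s" unfolding col_cone_def by blast
  then show "s \<in> cell_bases A b0" using basA by (simp add: cell_bases_def)
qed

lemma cell_bases_B_ne: "cell_bases B (proj b0) \<noteq> {}"
  using ne cell_bases_A_to_B by blast

lemma proj_surj: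
  assumes c: "c \<in> carrier_vec (d - l)"
  obtains v where "v \<in> carrier_vec d" "proj v = c"
proof -
  obtain J D where JD: "\<And>k. k < d - l \<Longrightarrow> J k < n \<and> (D k :: int) > 0 \<and>
      P *\<^sub>v col A (J k) = D k \<cdot>\<^sub>v unit_vec (d - l) k"
    using P_unit by metis
  define v where "v = vec d (\<lambda>r. \<Sum>k<d - l. c $ k / of_int (D k) * of_int (A $$ (r, J k)))"
  have "proj v = c"
  proof (rule eq_vecI)
    fix i assume "i < dim_vec c"
    then have i: "i < d - l" using c by simp
    have "proj v $ i = (\<Sum>r<d. \<Sum>k<d - l. of_int (P $$ (i, r)) * (c $ k / of_int (D k) * of_int (A $$ (r, J k))))"
      using i by (simp add: v_def scalar_prod_def atLeast0LessThan sum_distrib_left)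
    also have "\<dots> = (\<Sum>k<d - l. \<Sum>r<d. of_int (P $$ (i, r)) * (c $ k / of_int (D k) * of_int (A $$ (r, J k))))"
      by (rule sum.swap)
    also have "\<dots> = (\<Sum>k<d - l. if k = i then c $ i else 0)"
    proof (rule sum.cong)
      fix k assume "k \<in> {..<d - l}"
      then have k: "k < d - l" by simp
      have "of_int ((P *\<^sub>v col A (J k)) $ i) = (\<Sum>r<d. of_int (P $$ (i, r)) * (of_int (A $$ (r, J k)) :: real))"
        using JD[OF k] i by (intro proj_col_index) auto
      then have "(\<Sum>r<d. of_int (P $$ (i, r)) * (c $ k / of_int (D k) * of_int (A $$ (r, J k))))
          = c $ k / of_int (D k) * of_int ((P *\<^sub>v col A (J k)) $ i)"
        by (simp add: sum_distrib_left mult.left_commute)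
      also have "\<dots> = (if k = i then c $ i else 0)" using JD[OF k] i k by simp
      finally show "(\<Sum>r<d. of_int (P $$ (i, r)) * (c $ k / of_int (D k) * of_int (A $$ (r, J k))))
          = (if k = i then c $ i else 0)" .
    qed simp
    also have "\<dots> = c $ i" using i by simp
    finally show "proj v $ i = c $ i" .
  qed (use c in simp)
  moreover have "v \<in> carrier_vec d" by (simp add: v_def)
  ultimately show thesis using that by blast
qed

text \<open>Facet functionals of the cell are nonnegative on its own points, and the first
  \<open>l\<close> columns are such points. This allows movement along the kernel of the projection
  without leaving \<gamma>.\<close>

lemma add_first_columns:
  assumes v: "v \<in> \<gamma>" and c: "\<And>j. j < l \<Longrightarrow> 0 \<le> c j"
  shows "v + comb A {..<l} c \<in> \<gamma>"
proof -
  have "0 \<le> dual_basis A s i \<bullet> (v + comb A {..<l} c)" if s: "s \<in> cell_bases A b0" "i \<in> s" for s i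
  proof -
    let ?w = "dual_basis A s i"
    have w: "?w \<in> carrier_vec d" using dual_basis_carrier[OF cell_basesD(1)[OF s(1)]] by simp
    have wg: "0 \<le> ?w \<bullet> y" if "y \<in> \<gamma>" for y
      using that s mem_chamber_cell_iff[OF ne] \<gamma> by auto
    have "?w \<bullet> (v + comb A {..<l} c) = ?w \<bullet> v + (\<Sum>j<l. c j * (?w \<bullet> real_vec (col A j)))"
      using w v \<gamma>_carrier comb_carrier[of A "{..<l}" c] l_le_n scalar_prod_comb[of ?w A "{..<l}" c]
      by (subst scalar_prod_add_distrib[of _ d]) auto
    moreover have "0 \<le> (\<Sum>j<l. c j * (?w \<bullet> real_vec (col A j)))"
      using wg col_in_\<gamma> c by (intro sum_nonneg mult_nonneg_nonneg) auto
    ultimately show ?thesis using wg[OF v] by simp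
  qed
  moreover have "v + comb A {..<l} c \<in> carrier_vec (dim_row A)"
    using v \<gamma>_carrier comb_carrier[of A] by (auto intro!: add_carrier_vec)
  ultimately show ?thesis unfolding \<gamma> mem_chamber_cell_iff[OF ne] by blast
qed

text \<open>Coordinates at indices from \<open>l\<close> on factor through the projection and are
  conditions on the image point. Coordinates at indices below \<open>l\<close> can be made
  nonnegative by adding first columns, which does not change the image.\<close>

lemma projected_cell: "chamber_cell B (proj b0) = proj ` \<gamma>"
proof (intro equalityI subsetI)
  fix c assume "c \<in> proj ` \<gamma>"
  then obtain v where v: "v \<in> \<gamma>" "c = proj v" by blast
  have "c \<in> col_cone B t" if t: "t \<in> cell_bases B (proj b0)" for t
  proof -
    let ?s = "{..<l} \<union> (+) l ` t"
    note D = cell_basesD[OF cell_bases_B_to_A(1)[OF t]]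
    obtain x where x: "\<forall>j\<in>?s. 0 \<le> x j" "v = comb A ?s x" using v(1) D(5) by (auto simp: col_cone_def)
    have "c = comb B t (\<lambda>j. x (l + j))"
      unfolding v(2) x(2) proj_comb[OF D(2)] cell_bases_B_to_A(2)[OF t] ..
    then show ?thesis using x(1) unfolding col_cone_def by blast
  qed
  then show "c \<in> chamber_cell B (proj b0)" by (auto simp: chamber_cell_eq)
next
  fix c assume c: "c \<in> chamber_cell B (proj b0)"
  then have "c \<in> carrier_vec (d - l)" using chamber_cell_carrier[OF cell_bases_B_ne] by auto
  then obtain v where v: "v \<in> carrier_vec d" "proj v = c" by (rule proj_surj)
  \<comment> \<open>A common bound for the absolute values of all coordinates below \<open>l\<close>
    in all cell bases.\<close>
  define \<mu> where "\<mu> = (\<Sum>s\<in>cell_bases A b0. \<Sum>i<l. \<bar>dual_basis A s i \<bullet> v\<bar>)"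
  let ?v = "v + comb A {..<l} (\<lambda>_. \<mu>)"
  have cc: "comb A {..<l} (\<lambda>_. \<mu>) \<in> carrier_vec d" using comb_carrier[of A] by simp
  have "0 \<le> dual_basis A s i \<bullet> ?v" if s: "s \<in> cell_bases A b0" and i: "i \<in> s" for s i
  proof -
    let ?w = "dual_basis A s"
    note D = cell_basesD[OF s]
    have w: "?w i \<in> carrier_vec d" using dual_basis_carrier[OF D(1)] by simp
    have "comb A {..<l} (\<lambda>_. \<mu>) = comb A s (\<lambda>j. if j \<in> {..<l} then \<mu> else 0)"
      using comb_superset[OF col_basis_finite[OF D(1)] D(4), of A "\<lambda>_. \<mu>"] by simp
    then have "?w i \<bullet> comb A {..<l} (\<lambda>_. \<mu>) = (if i < l then \<mu> else 0)"
      using dual_basis_comb[OF D(1) i] by simp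
    then have wv: "?w i \<bullet> ?v = ?w i \<bullet> v + (if i < l then \<mu> else 0)"
      using scalar_prod_add_distrib[OF w v(1) cc] by simp
    show ?thesis
    proof (cases "i < l")
      case True
      have "\<bar>?w i \<bullet> v\<bar> \<le> (\<Sum>i<l. \<bar>?w i \<bullet> v\<bar>)"
        using True by (intro member_le_sum[of i "{..<l}" "\<lambda>i. \<bar>?w i \<bullet> v\<bar>"]) auto
      also have "\<dots> \<le> \<mu>" unfolding \<mu>_def
        using s finite_cell_bases
        by (intro member_le_sum[of s "cell_bases A b0" "\<lambda>s. \<Sum>i<l. \<bar>dual_basis A s i \<bullet> v\<bar>"]) (auto intro: sum_nonneg)
      finally show ?thesis using wv True by simp
    next
      case False
      have "c \<in> col_cone B {j. l + j \<in> s}"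
        using c cell_bases_A_to_B[OF s] unfolding chamber_cell_eq by blast
      then obtain y where y: "\<forall>j\<in>{j. l + j \<in> s}. 0 \<le> y j" "c = comb B {j. l + j \<in> s} y"
        by (auto simp: col_cone_def)
      then obtain x where "v = comb A s (\<lambda>j. if j < l then x j else y (j - l))"
        using lift_comb[OF D(2,4) v(1)] v(2) by blast
      \<comment> \<open>From \<open>l\<close> on, the coordinate of the lift is the coordinate of
        \<open>c\<close> in the corresponding basis of \<open>B\<close>.\<close>
      then have "?w i \<bullet> v = y (i - l)" using dual_basis_comb[OF D(1) i] False by simp
      moreover have "0 \<le> y (i - l)" using y(1) i False by simp
      ultimately show ?thesis using wv False by simp
    qed
  qed
  then have "?v \<in> \<gamma>" unfolding \<gamma> mem_chamber_cell_iff[OF ne] using v(1) cc by auto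
  moreover have "proj ?v = c" using proj_add[OF v(1) cc] v proj_comb_first \<open>c \<in> carrier_vec (d - l)\<close> by simp
  ultimately show "c \<in> proj ` \<gamma>" by blast
qed

lemma projected_chamber: "proj ` \<gamma> \<in> chambers B"
proof -
  have sub: "proj ` \<gamma> \<subseteq> carrier_vec (d - l)"
    using chamber_cell_carrier[OF cell_bases_B_ne] projected_cell by simp
  obtain p where p: "p \<in> \<gamma>" "cell_interior A b0 p" by (rule interior)
  have "cone_dim (d - l) (proj ` \<gamma>) = d - l"
  proof (rule cone_dim_full[OF sub])
    fix c :: "real vec" assume "c \<in> carrier_vec (d - l)"
    then obtain v where v: "v \<in> carrier_vec d" "proj v = c" by (rule proj_surj)
    obtain x y where xy: "x \<in> \<gamma>" "y \<in> \<gamma>" "v = x - y"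
      using cell_diff[OF ne p(2), of v] p(1) v(1) \<gamma> unfolding dims by blast
    then have "c = proj x - proj y" using v(2) proj_diff \<gamma>_carrier by blast
    then show "\<exists>x\<in>proj ` \<gamma>. \<exists>y\<in>proj ` \<gamma>. c = x - y" using xy by blast
  qed
  moreover obtain t where "t \<in> cell_bases B (proj b0)" using cell_bases_B_ne by blast
  then have "proj b0 \<in> col_cone B t" "t \<subseteq> {..<n - l}" by (auto simp: cell_bases_def col_basis_def)
  then have "proj b0 \<in> pos_cone B"
    using col_cone_mono[of "{..<n - l}" t B] by (auto simp: pos_cone_eq_col_cone)
  \<comment> \<open>The zero normal exhibits the cell as a face of itself.\<close>
  moreover have "is_face (d - l) (proj ` \<gamma>) (chamber_cell B (proj b0))"
    unfolding is_face_def projected_cell using sub by (intro bexI[of _ "0\<^sub>v (d - l)"]) auto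
  ultimately show ?thesis unfolding chambers_def chamber_complex_def by auto
qed

section \<open>Bijection between the solutions of the two systems\<close>

lemma vpf_projection:
  assumes b: "b \<in> lattice_of A" "real_vec b \<in> \<gamma>"
  shows "vpf A b = vpf B (P *\<^sub>v b)"
proof -
  define X where "X = {x \<in> carrier_vec n. A *\<^sub>v map_vec int x = b}"
  define Y where "Y = {y \<in> carrier_vec (n - l). B *\<^sub>v map_vec int y = P *\<^sub>v b}"
  define f :: "nat vec \<Rightarrow> nat vec" where "f x = vec (n - l) (\<lambda>j. x $ (l + j))" for x
  obtain x0 where x0: "x0 \<in> carrier_vec n" "b = A *\<^sub>v x0" using b(1) by (auto simp: lattice_of_def)
  have bc: "b \<in> carrier_vec d" using x0 A by simp
  have realP: "real_vec (P *\<^sub>v b) = proj (real_vec b)" using bc by (intro real_mult_mat_vec) simp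
  have X_iff: "x \<in> X \<longleftrightarrow> x \<in> carrier_vec n \<and> comb A {..<n} (\<lambda>j. real (x $ j)) = real_vec b" for x
  proof -
    have "A *\<^sub>v map_vec int x = b \<longleftrightarrow> real_vec (A *\<^sub>v map_vec int x) = real_vec b"
      by (rule real_vec_eq_iff[symmetric])
    moreover have "real_vec (A *\<^sub>v map_vec int x) = comb A {..<n} (\<lambda>j. real (x $ j))" if "x \<in> carrier_vec n"
      using that by (subst real_mult_mat_vec_comb) (auto intro: comb_cong)
    ultimately show ?thesis by (auto simp: X_def)
  qed
  have Y_iff: "y \<in> Y \<longleftrightarrow> y \<in> carrier_vec (n - l) \<and> comb B {..<n - l} (\<lambda>j. real (y $ j)) = proj (real_vec b)" for y
  proof -
    have "B *\<^sub>v map_vec int y = P *\<^sub>v b \<longleftrightarrow> real_vec (B *\<^sub>v map_vec int y) = real_vec (P *\<^sub>v b)"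
      by (rule real_vec_eq_iff[symmetric])
    moreover have "real_vec (B *\<^sub>v map_vec int y) = comb B {..<n - l} (\<lambda>j. real (y $ j))" if "y \<in> carrier_vec (n - l)"
      using that by (subst real_mult_mat_vec_comb) (auto intro: comb_cong)
    ultimately show ?thesis using realP by (auto simp: Y_def)
  qed
  have ind: "{j. l + j \<in> {..<n}} = {..<n - l}" by auto
  \<comment> \<open>Dropping the first \<open>l\<close> entries is injective because the first
    columns are independent. Surjectivity has to turn nonnegative real coefficients on these columns
    into natural numbers, which is where saturation enters.\<close>
  have "bij_betw f X Y"
    unfolding bij_betw_def
  proof
    show "inj_on f X"
    proof (rule inj_onI)
      fix x x' assume xx: "x \<in> X" "x' \<in> X" "f x = f x'"
      have dims: "dim_vec x = n" "dim_vec x' = n" using xx by (auto simp: X_iff)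
      have tail: "x $ j = x' $ j" if "l \<le> j" "j < n" for j
      proof -
        have "l + (j - l) = j" "j - l < n - l" using that by auto
        then show ?thesis using arg_cong[OF xx(3), of "\<lambda>v. v $ (j - l)"] by (simp add: f_def)
      qed
      have "comb A {..<l} (\<lambda>j. real (x $ j) - real (x' $ j))
          = comb A {..<n} (\<lambda>j. if j \<in> {..<l} then real (x $ j) - real (x' $ j) else 0)"
        using comb_superset[of "{..<n}" "{..<l}" A] l_le_n by simp
      also have "\<dots> = comb A {..<n} (\<lambda>j. real (x $ j) - real (x' $ j))"
        using tail by (intro comb_cong) auto
      also have "\<dots> = 0\<^sub>v d" unfolding comb_diff using xx bc by (simp add: X_iff)
      also have "\<dots> = comb A {..<l} (\<lambda>_. 0)" by (auto simp: comb_def)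
      finally have "x $ j = x' $ j" if "j < l" for j
        using first_columns_indep[of "\<lambda>j. real (x $ j) - real (x' $ j)" "\<lambda>_. 0"] that by simp
      with tail show "x = x'" using dims by (intro eq_vecI) (auto, metis linorder_not_le)
    qed
    show "f ` X = Y"
    proof (intro equalityI subsetI)
      fix y assume "y \<in> f ` X"
      then obtain x where x: "x \<in> X" "y = f x" by blast
      have "proj (real_vec b) = comb B {..<n - l} (\<lambda>j. real (x $ (l + j)))"
        using x(1) proj_comb[of "{..<n}" "\<lambda>j. real (x $ j)"] ind by (simp add: X_iff)
      also have "\<dots> = comb B {..<n - l} (\<lambda>j. real (y $ j))"
        unfolding x(2) f_def by (rule comb_cong) simp
      finally show "y \<in> Y" using x(2) by (simp add: Y_iff f_def)
    next
      fix y assume y: "y \<in> Y"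
      have rb: "real_vec b \<in> carrier_vec d" using bc by simp
      obtain x where x: "real_vec b = comb A {..<n} (\<lambda>j. if j < l then x j else real (y $ (j - l)))"
        using lift_comb[of "{..<n}" "real_vec b" "\<lambda>j. real (y $ j)"] l_le_n rb y ind
        by (auto simp: Y_iff)
      have xpos: "0 \<le> x j" if "j < l" for j
        using coeff_nonneg[OF b(2) x _ that] that by auto
      \<comment> \<open>With zeros in the first \<open>l\<close> places, \<open>y'\<close> accounts
        for the given part of the solution; the integral remainder \<open>w\<close> then has to be
        generated by the first columns alone.\<close>
      define y' where "y' = vec n (\<lambda>j. if j < l then 0 else int (y $ (j - l)))"
      define w where "w = b - A *\<^sub>v y'"
      have y'c: "y' \<in> carrier_vec n" by (simp add: y'_def)
      have Ay: "real_vec (A *\<^sub>v y') = comb A {..<n} (\<lambda>j. if j < l then 0 else real (y $ (j - l)))"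
        using y'c by (subst real_mult_mat_vec_comb) (auto simp: y'_def intro: comb_cong)
      have sh: "comb A {..<n} (\<lambda>j. if j < l then z j else real (y $ (j - l)))
          = comb A {..<l} z + comb A ({..<n} - {..<l}) (\<lambda>j. real (y $ (j - l)))" for z
        using comb_shift[of "{..<n}" z "\<lambda>j. real (y $ j)"] l_le_n by simp
      have z0: "comb A {..<l} (\<lambda>j. 0) = 0\<^sub>v d" by (auto simp: comb_def)
      have "real_vec w = real_vec b - real_vec (A *\<^sub>v y')"
        using bc A by (auto simp: w_def intro!: eq_vecI)
      also have "\<dots> = comb A {..<l} x"
        unfolding x Ay sh z0 using comb_carrier[of A "{..<l}" x] comb_carrier[of A "{..<n} - {..<l}" "\<lambda>j. real (y $ (j - l))"]
        by (intro eq_vecI) auto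
      finally have rw: "real_vec w = comb A {..<l} x" .
      have lsub: "{..<l} \<subseteq> {..<dim_col A}" using l_le_n by simp
      have "w = A *\<^sub>v (x0 - y')"
        unfolding w_def x0(2) using mult_minus_distrib_mat_vec[OF A x0(1) y'c] by simp
      then have "w \<in> lattice_of A" using x0(1) y'c by (auto simp: lattice_of_def)
      moreover have "real_vec w \<in> pos_cone (cols_sub A {..<l})"
        unfolding pos_cone_cols_sub[OF lsub] rw col_cone_def using xpos by auto
      \<comment> \<open>The remainder lies in the lattice of \<open>A\<close>, as \<open>b\<close>
        does, and in the cone of the first columns by \<open>coeff_nonneg\<close>; saturation now
        gives natural coefficients.\<close>
      ultimately have "w \<in> semigroup_of (cols_sub A {..<l})" using sat by (simp add: saturated_in_def)
      then obtain z where z: "z \<in> carrier_vec (card {..<l})" "w = cols_sub A {..<l} *\<^sub>v map_vec int z"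
        unfolding semigroup_of_def submatrix_cols(2)[OF lsub] by auto
      obtain z' where z': "z = vec (card {..<l}) (\<lambda>k. z' (pick {..<l} k))"
        using vec_over_pick[OF _ z(1)] by auto
      have "real_vec w = real_mat (cols_sub A {..<l}) *\<^sub>v real_vec (map_vec int z)"
        unfolding z(2) using z(1) submatrix_cols(2)[OF lsub] by (intro real_mult_mat_vec) simp
      also have "real_vec (map_vec int z) = vec (card {..<l}) (\<lambda>k. real (z' (pick {..<l} k)))"
        unfolding z' by (intro eq_vecI) auto
      also have "real_mat (cols_sub A {..<l}) *\<^sub>v \<dots> = comb A {..<l} (\<lambda>j. real (z' j))"
        using comb_cols_sub[OF lsub, of "\<lambda>j. real (z' j)"] .
      finally have eq: "comb A {..<l} x = comb A {..<l} (\<lambda>j. real (z' j))" using rw by simp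
      define v where "v = vec n (\<lambda>j. if j < l then z' j else y $ (j - l))"
      have "comb A {..<n} (\<lambda>j. real (v $ j)) = comb A {..<n} (\<lambda>j. if j < l then real (z' j) else real (y $ (j - l)))"
        by (rule comb_cong) (auto simp: v_def)
      also have "\<dots> = real_vec b" unfolding x sh eq ..
      finally have "v \<in> X" by (simp add: X_iff v_def)
      moreover have "f v = y" using y by (auto simp: f_def v_def Y_iff intro!: eq_vecI)
      ultimately show "y \<in> f ` X" by blast
    qed
  qed
  then have "card X = card Y" by (rule bij_betw_same_card)
  then show ?thesis by (simp add: vpf_def X_def Y_def)
qed

end

subsection \<open>Quasi-polynomials\<close>

text \<open>Exponents may repeat in an indexed family; coefficients belonging to the same monomial
  are added. This spares sums and products from collecting like terms.\<close>

lemma polynomial_funI: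
  assumes K: "finite K" and e: "\<And>k. k \<in> K \<Longrightarrow> e k \<in> carrier_vec d"
    and g: "\<And>b. b \<in> carrier_vec d \<Longrightarrow> g b = (\<Sum>k\<in>K. c k * (\<Prod>i<d. of_int (b $ i) ^ (e k $ i)))"
  shows "polynomial_fun d g"
  unfolding polynomial_fun_def
proof (intro exI conjI ballI)
  show "finite (e ` K)" "e ` K \<subseteq> carrier_vec d" using K e by auto
  fix b :: "int vec" assume b: "b \<in> carrier_vec d"
  have "g b = (\<Sum>v\<in>e ` K. \<Sum>k\<in>{k \<in> K. e k = v}. c k * (\<Prod>i<d. of_int (b $ i) ^ (e k $ i)))"
    unfolding g[OF b] by (rule sum.image_gen[OF K])
  also have "\<dots> = (\<Sum>v\<in>e ` K. (\<Sum>k\<in>{k \<in> K. e k = v}. c k) * (\<Prod>i<d. of_int (b $ i) ^ (v $ i)))"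
    by (simp add: sum_distrib_right)
  finally show "g b = (\<Sum>v\<in>e ` K. (\<lambda>v. \<Sum>k\<in>{k \<in> K. e k = v}. c k) v * (\<Prod>i<d. of_int (b $ i) ^ (v $ i)))" .
qed

lemma polynomial_funE:
  assumes "polynomial_fun d g"
  obtains E c where "finite E" "E \<subseteq> carrier_vec d"
    "\<And>b. b \<in> carrier_vec d \<Longrightarrow> g b = (\<Sum>e\<in>E. c e * (\<Prod>i<d. of_int (b $ i) ^ (e $ i)))"
  using assms unfolding polynomial_fun_def by blast

lemma polynomial_fun_const: "polynomial_fun d (\<lambda>_. a)"
  by (rule polynomial_funI[of "{()}" "\<lambda>_. 0\<^sub>v d" _ _ "\<lambda>_. a"]) auto

lemma polynomial_fun_coord:
  assumes "i < d"
  shows "polynomial_fun d (\<lambda>b. of_int (b $ i))"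
proof (rule polynomial_funI[of "{()}" "\<lambda>_. unit_vec d i" _ _ "\<lambda>_. 1"])
  fix b :: "int vec"
  have "(\<Prod>j<d. of_int (b $ j) ^ (unit_vec d i $ j)) = (\<Prod>j<d. if j = i then of_int (b $ i) else (1 :: rat))"
    using assms by (intro prod.cong) auto
  then show "of_int (b $ i) = (\<Sum>k\<in>{()}. 1 * (\<Prod>j<d. (of_int (b $ j) :: rat) ^ (unit_vec d i $ j)))"
    using assms by simp
qed auto

lemma polynomial_fun_add:
  assumes f: "polynomial_fun d f" and g: "polynomial_fun d g"
  shows "polynomial_fun d (\<lambda>b. f b + g b)"
proof -
  obtain E c where E: "finite E" "E \<subseteq> carrier_vec d"
    "\<And>b. b \<in> carrier_vec d \<Longrightarrow> f b = (\<Sum>e\<in>E. c e * (\<Prod>i<d. of_int (b $ i) ^ (e $ i)))"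
    using f by (rule polynomial_funE) blast
  obtain E' c' where E': "finite E'" "E' \<subseteq> carrier_vec d"
    "\<And>b. b \<in> carrier_vec d \<Longrightarrow> g b = (\<Sum>e\<in>E'. c' e * (\<Prod>i<d. of_int (b $ i) ^ (e $ i)))"
    using g by (rule polynomial_funE) blast
  show ?thesis
    by (rule polynomial_funI[of "E <+> E'" "case_sum id id" _ _ "case_sum c c'"])
      (use E E' in \<open>auto simp: sum.Plus\<close>)
qed

lemma polynomial_fun_mult:
  assumes f: "polynomial_fun d f" and g: "polynomial_fun d g"
  shows "polynomial_fun d (\<lambda>b. f b * g b)"
proof -
  obtain E c where E: "finite E" "E \<subseteq> carrier_vec d"
    "\<And>b. b \<in> carrier_vec d \<Longrightarrow> f b = (\<Sum>e\<in>E. c e * (\<Prod>i<d. of_int (b $ i) ^ (e $ i)))"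
    using f by (rule polynomial_funE) blast
  obtain E' c' where E': "finite E'" "E' \<subseteq> carrier_vec d"
    "\<And>b. b \<in> carrier_vec d \<Longrightarrow> g b = (\<Sum>e\<in>E'. c' e * (\<Prod>i<d. of_int (b $ i) ^ (e $ i)))"
    using g by (rule polynomial_funE) blast
  show ?thesis
  proof (rule polynomial_funI[of "E \<times> E'" "\<lambda>(e, e'). e + e'" _ _ "\<lambda>(e, e'). c e * c' e'"])
    fix b :: "int vec" assume b: "b \<in> carrier_vec d"
    have "f b * g b = (\<Sum>(e, e')\<in>E \<times> E'. (c e * (\<Prod>i<d. of_int (b $ i) ^ (e $ i))) *
        (c' e' * (\<Prod>i<d. of_int (b $ i) ^ (e' $ i))))"
      unfolding E(3)[OF b] E'(3)[OF b] by (simp add: sum_product sum.cartesian_product)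
    also have "\<dots> = (\<Sum>k\<in>E \<times> E'. (case k of (e, e') \<Rightarrow> c e * c' e') *
        (\<Prod>i<d. of_int (b $ i) ^ ((case k of (e, e') \<Rightarrow> e + e') $ i)))"
    proof (intro sum.cong refl, clarify)
      fix e e' assume e: "e \<in> E" "e' \<in> E'"
      have "(\<Prod>i<d. (of_int (b $ i) :: rat) ^ ((e + e') $ i))
        = (\<Prod>i<d. of_int (b $ i) ^ (e $ i)) * (\<Prod>i<d. of_int (b $ i) ^ (e' $ i))"
        using e E(2) E'(2) by (subst prod.distrib[symmetric]) (auto simp: power_add subset_iff intro!: prod.cong)
      then show "c e * (\<Prod>i<d. of_int (b $ i) ^ (e $ i)) * (c' e' * (\<Prod>i<d. of_int (b $ i) ^ (e' $ i)))
        = c e * c' e' * (\<Prod>i<d. of_int (b $ i) ^ ((e + e') $ i))"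
        by simp
    qed
    finally show "f b * g b = (\<Sum>k\<in>E \<times> E'. (case k of (e, e') \<Rightarrow> c e * c' e') *
        (\<Prod>i<d. of_int (b $ i) ^ ((case k of (e, e') \<Rightarrow> e + e') $ i)))" .
  qed (use E(1,2) E'(1,2) in \<open>auto simp: subset_iff\<close>)
qed

lemma polynomial_fun_sum:
  "finite I \<Longrightarrow> (\<And>i. i \<in> I \<Longrightarrow> polynomial_fun d (f i)) \<Longrightarrow> polynomial_fun d (\<lambda>b. \<Sum>i\<in>I. f i b)"
  by (induction I rule: finite_induct) (auto intro: polynomial_fun_const polynomial_fun_add)

lemma polynomial_fun_prod:
  "finite I \<Longrightarrow> (\<And>i. i \<in> I \<Longrightarrow> polynomial_fun d (f i)) \<Longrightarrow> polynomial_fun d (\<lambda>b. \<Prod>i\<in>I. f i b)"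
  by (induction I rule: finite_induct) (auto intro: polynomial_fun_const polynomial_fun_mult)

lemma polynomial_fun_power: "polynomial_fun d f \<Longrightarrow> polynomial_fun d (\<lambda>b. f b ^ k)"
  by (induction k) (auto intro: polynomial_fun_const polynomial_fun_mult)

text \<open>The arguments of \<open>g\<close> are integer vectors, whereas the substituted functions
  are rational-valued and may be integral only for some \<open>c\<close>. Hence the composition is
  stated pointwise, under the condition that the values agree.\<close>

lemma polynomial_fun_subst:
  assumes g: "polynomial_fun d g" and F: "\<And>i. i < d \<Longrightarrow> polynomial_fun m (F i)"
  shows "\<exists>h. polynomial_fun m h \<and>
    (\<forall>b\<in>carrier_vec d. \<forall>c. (\<forall>i<d. of_int (b $ i) = F i c) \<longrightarrow> g b = h c)"
proof -
  obtain E a where E: "finite E" "E \<subseteq> carrier_vec d"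
    "\<And>b. b \<in> carrier_vec d \<Longrightarrow> g b = (\<Sum>e\<in>E. a e * (\<Prod>i<d. of_int (b $ i) ^ (e $ i)))"
    using g by (rule polynomial_funE) blast
  define h where "h c = (\<Sum>e\<in>E. a e * (\<Prod>i<d. F i c ^ (e $ i)))" for c
  have "polynomial_fun m h"
    unfolding h_def using E(1) F
    by (intro polynomial_fun_sum polynomial_fun_mult polynomial_fun_const polynomial_fun_prod
        polynomial_fun_power) auto
  moreover have "g b = h c" if "b \<in> carrier_vec d" "\<forall>i<d. of_int (b $ i) = F i c" for b c
    using that by (simp add: E(3) h_def)
  ultimately show ?thesis by blast
qed

lemma polynomial_fun_on_line:
  assumes g: "polynomial_fun d g" and ab: "a \<in> carrier_vec d" "b \<in> carrier_vec d"
  obtains p :: "rat poly" where "\<And>m. g (b + m \<cdot>\<^sub>v a) = poly p (of_int m)"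
proof -
  obtain E c where E: "finite E" "E \<subseteq> carrier_vec d"
    "\<And>b. b \<in> carrier_vec d \<Longrightarrow> g b = (\<Sum>e\<in>E. c e * (\<Prod>i<d. of_int (b $ i) ^ (e $ i)))"
    using g by (rule polynomial_funE) blast
  define p :: "rat poly" where
    "p = (\<Sum>e\<in>E. [:c e:] * (\<Prod>i<d. [:of_int (b $ i), of_int (a $ i):] ^ (e $ i)))"
  have "g (b + m \<cdot>\<^sub>v a) = poly p (of_int m)" for m
    using ab by (simp add: E(3) p_def poly_sum poly_prod)
  then show thesis using that by blast
qed

text \<open>The difference from the constant has infinitely many roots. The conclusion reaches
  arguments below \<open>m0\<close>, which is the purpose of the lemma.\<close>

lemma poly_eventually_const:
  fixes p :: "rat poly"
  assumes "\<And>m. m \<ge> m0 \<Longrightarrow> poly p (of_int m) = a"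
  shows "poly p x = a"
proof -
  have "infinite (of_int ` {m0..} :: rat set)"
    by (subst finite_image_iff) (auto simp: inj_on_def infinite_Ici)
  moreover have "of_int ` {m0..} \<subseteq> {x. poly (p - [:a:]) x = 0}" using assms by auto
  ultimately have "infinite {x. poly (p - [:a:]) x = 0}" using finite_subset by blast
  then have "p - [:a:] = 0" using poly_roots_finite by blast
  then show ?thesis by (metis eq_iff_diff_eq_0 poly_0 poly_diff poly_pCons mult_zero_right add.right_neutral)
qed

lemma mult_mat_vec_smult:
  fixes A :: "int mat"
  assumes "A \<in> carrier_mat r k" "x \<in> carrier_vec k"
  shows "A *\<^sub>v (m \<cdot>\<^sub>v x) = m \<cdot>\<^sub>v (A *\<^sub>v x)"
  using assms by (intro eq_vecI) auto

lemma lattice_of_add: "a \<in> lattice_of A \<Longrightarrow> b \<in> lattice_of A \<Longrightarrow> a + b \<in> lattice_of A"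
proof -
  assume "a \<in> lattice_of A" "b \<in> lattice_of A"
  then obtain x y where xy: "x \<in> carrier_vec (dim_col A)" "y \<in> carrier_vec (dim_col A)"
      "a = A *\<^sub>v x" "b = A *\<^sub>v y"
    by (auto simp: lattice_of_def)
  then have "a + b = A *\<^sub>v (x + y)" using mult_add_distrib_mat_vec[of A "dim_row A" "dim_col A" x y] by simp
  then show ?thesis using xy by (auto simp: lattice_of_def)
qed

lemma lattice_of_smult: "a \<in> lattice_of A \<Longrightarrow> m \<cdot>\<^sub>v a \<in> lattice_of A"
proof -
  assume "a \<in> lattice_of A"
  then obtain x where x: "x \<in> carrier_vec (dim_col A)" "a = A *\<^sub>v x" by (auto simp: lattice_of_def)
  then have "m \<cdot>\<^sub>v a = A *\<^sub>v (m \<cdot>\<^sub>v x)" using mult_mat_vec_smult[of A "dim_row A" "dim_col A" x m] by simp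
  then show ?thesis using x(1) by (auto simp: lattice_of_def)
qed

lemma lattice_of_cols_sum:
  assumes "finite K" "\<And>k. k \<in> K \<Longrightarrow> J k < dim_col A"
  shows "vec (dim_row A) (\<lambda>r. \<Sum>k\<in>K. w k * A $$ (r, J k)) \<in> lattice_of A"
proof -
  \<comment> \<open>\<open>J\<close> need not be injective, so weights that fall on the same column
    are accumulated.\<close>
  define x where "x = vec (dim_col A) (\<lambda>j. \<Sum>k\<in>K. if J k = j then w k else 0)"
  have "vec (dim_row A) (\<lambda>r. \<Sum>k\<in>K. w k * A $$ (r, J k)) = A *\<^sub>v x"
  proof (rule eq_vecI)
    fix r assume "r < dim_vec (A *\<^sub>v x)"
    then have r: "r < dim_row A" by simp
    have "(A *\<^sub>v x) $ r = (\<Sum>j<dim_col A. \<Sum>k\<in>K. A $$ (r, j) * (if J k = j then w k else 0))"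
      using r by (simp add: x_def scalar_prod_def atLeast0LessThan sum_distrib_left)
    also have "\<dots> = (\<Sum>k\<in>K. \<Sum>j<dim_col A. A $$ (r, j) * (if J k = j then w k else 0))"
      by (rule sum.swap)
    also have "\<dots> = (\<Sum>k\<in>K. w k * A $$ (r, J k))"
    proof (rule sum.cong)
      fix k assume "k \<in> K"
      then have "J k < dim_col A" using assms by simp
      then show "(\<Sum>j<dim_col A. A $$ (r, j) * (if J k = j then w k else 0)) = w k * A $$ (r, J k)"
        by (simp add: if_distrib cong: if_cong)
    qed simp
    finally show "vec (dim_row A) (\<lambda>r. \<Sum>k\<in>K. w k * A $$ (r, J k)) $ r = (A *\<^sub>v x) $ r"
      using r by simp
  qed simp
  then show ?thesis by (auto simp: lattice_of_def x_def)
qed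

section \<open>Transport of the quasi-polynomial from A to B\<close>

context chamber_projection
begin

lemma lattice_of_carrier: "b \<in> lattice_of A \<Longrightarrow> b \<in> carrier_vec d"
  using A by (auto simp: lattice_of_def)

lemma real_proj: "b \<in> carrier_vec d \<Longrightarrow> real_vec (P *\<^sub>v b) = proj (real_vec b)"
  by (intro real_mult_mat_vec) simp

text \<open>A solution for \<open>B\<close>, extended by zeros in the first \<open>l\<close> places,
  would be an integral combination of columns of \<open>A\<close> that projects to
  \<open>c\<close>.\<close>

lemma vpf_B_outside_lattice:
  assumes "c \<notin> (\<lambda>b. P *\<^sub>v b) ` lattice_of A"
  shows "vpf B c = 0"
proof -
  have "B *\<^sub>v map_vec int y \<noteq> c" if y: "y \<in> carrier_vec (n - l)" for y
  proof
    assume eq: "B *\<^sub>v map_vec int y = c"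
    define x where "x = vec n (\<lambda>j. if j < l then 0 else int (y $ (j - l)))"
    have x: "x \<in> carrier_vec n" by (simp add: x_def)
    have "real_vec (P *\<^sub>v (A *\<^sub>v x)) = proj (comb A {..<n} (\<lambda>j. of_int (x $ j)))"
      using x A by (subst real_proj) (auto simp: real_mult_mat_vec_comb)
    also have "\<dots> = comb B {j. l + j \<in> {..<n}} (\<lambda>j. of_int (x $ (l + j)))" by (rule proj_comb) simp
    also have "{j. l + j \<in> {..<n}} = {..<n - l}" by auto
    also have "comb B {..<n - l} (\<lambda>j. of_int (x $ (l + j))) = comb B {..<n - l} (\<lambda>j. of_int (map_vec int y $ j))"
      using y by (intro comb_cong) (auto simp: x_def)
    also have "\<dots> = real_vec c" using y eq[symmetric] by (simp add: real_mult_mat_vec_comb)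
    finally have "P *\<^sub>v (A *\<^sub>v x) = c" by (simp only: real_vec_eq_iff)
    then show False using assms x by (auto simp: lattice_of_def)
  qed
  then have "{x \<in> carrier_vec (dim_col B). B *\<^sub>v map_vec int x = c} = {}" by simp
  then show ?thesis unfolding vpf_def by (simp only: card.empty)
qed

text \<open>The projected lattice contains a positive multiple \<open>D i\<close> of each unit
  vector, so it has finite index; the columns selected by \<open>J\<close> give explicit preimages
  that depend linearly on \<open>w\<close>.\<close>

lemma lattice_scale:
  obtains D J where "\<And>k. k < d - l \<Longrightarrow> J k < n" "\<And>k. k < d - l \<Longrightarrow> (D k :: int) > 0"
    "\<And>w i. i < d - l \<Longrightarrow> (P *\<^sub>v vec d (\<lambda>r. \<Sum>k<d - l. w k * A $$ (r, J k))) $ i = w i * D i"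
proof -
  obtain J D where JD: "\<And>k. k < d - l \<Longrightarrow> J k < n \<and> (D k :: int) > 0 \<and>
      P *\<^sub>v col A (J k) = D k \<cdot>\<^sub>v unit_vec (d - l) k"
    using P_unit by metis
  have "(P *\<^sub>v vec d (\<lambda>r. \<Sum>k<d - l. w k * A $$ (r, J k))) $ i = w i * D i" if i: "i < d - l" for w i
  proof -
    have "(P *\<^sub>v vec d (\<lambda>r. \<Sum>k<d - l. w k * A $$ (r, J k))) $ i
        = (\<Sum>r<d. \<Sum>k<d - l. P $$ (i, r) * (w k * A $$ (r, J k)))"
      using i by (simp add: scalar_prod_def atLeast0LessThan sum_distrib_left)
    also have "\<dots> = (\<Sum>k<d - l. \<Sum>r<d. P $$ (i, r) * (w k * A $$ (r, J k)))" by (rule sum.swap)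
    also have "\<dots> = (\<Sum>k<d - l. if k = i then w i * D i else 0)"
    proof (rule sum.cong)
      fix k assume "k \<in> {..<d - l}"
      then have k: "k < d - l" by simp
      have "(\<Sum>r<d. P $$ (i, r) * (w k * A $$ (r, J k))) = w k * (P *\<^sub>v col A (J k)) $ i"
      proof -
        have "(P *\<^sub>v col A (J k)) $ i = (\<Sum>r<d. P $$ (i, r) * A $$ (r, J k))"
          using JD[OF k, THEN conjunct1] i by (simp add: scalar_prod_def atLeast0LessThan)
        then show ?thesis by (simp add: sum_distrib_left mult.left_commute)
      qed
      then show "(\<Sum>r<d. P $$ (i, r) * (w k * A $$ (r, J k))) = (if k = i then w i * D i else 0)"
        using JD[OF k] i k by simp
    qed simp
    also have "\<dots> = w i * D i" using i by simp
    finally show ?thesis .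
  qed
  then show thesis using that JD by blast
qed

text \<open>The quasi-polynomial of \<open>B\<close> is \<open>pA\<close> composed with a section of the projection that is affine on each residue class. A lift of a point of the
  projected chamber need not lie in \<open>\<gamma>\<close>, but it enters \<open>\<gamma>\<close> after adding large multiples of the
  columns spanning the kernel, and along this direction \<open>pA\<close> is a polynomial that is eventually constant,
  hence constant.\<close>

lemma quasi_polynomial_projection:
  assumes pA: "chamber_qp A \<gamma> pA"
  obtains pB where "chamber_qp B (proj ` \<gamma>) pB"
    "\<And>b. b \<in> lattice_of A \<Longrightarrow> real_vec b \<in> \<gamma> \<Longrightarrow> pA b = pB (P *\<^sub>v b)"
proof -
  let ?e = "d - l"
  obtain NA where NA: "(NA :: int) > 0" and qp: "\<And>r. r \<in> carrier_vec d \<Longrightarrow> \<exists>g. polynomial_fun d g \<and>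
      (\<forall>b\<in>carrier_vec d. (\<forall>i<d. b $ i mod NA = r $ i mod NA) \<longrightarrow> pA b = g b)"
    and agree: "\<And>b. b \<in> carrier_vec d \<Longrightarrow> real_vec b \<in> \<gamma> \<Longrightarrow> pA b = of_nat (vpf A b)"
    using pA by (auto simp: chamber_qp_def quasi_polynomial_def)
  obtain D J where J: "\<And>k. k < ?e \<Longrightarrow> J k < n" and D: "\<And>k. k < ?e \<Longrightarrow> (D k :: int) > 0"
    and scale: "\<And>w i. i < ?e \<Longrightarrow> (P *\<^sub>v vec d (\<lambda>r. \<Sum>k<?e. w k * A $$ (r, J k))) $ i = w i * D i"
    by (rule lattice_scale) blast
  \<comment> \<open>A multiple of \<open>NA\<close> times every \<open>D k\<close>: a vector
    divisible by \<open>N\<close> can be lifted to \<open>NA\<close> times a lattice vector.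
    \<open>Q k\<close> is the cofactor with \<open>NA * Q k * D k\<close> =
    \<open>N\<close>.\<close>
  define N where "N = NA * (\<Prod>k<?e. D k)"
  define Q where "Q k = (\<Prod>j\<in>{..<?e} - {k}. D j)" for k
  have "(\<Prod>k<?e. D k) > 0" using D by (intro prod_pos) auto
  then have N: "N > 0" using NA by (simp add: N_def)
  have NQ: "N = NA * Q k * D k" if "k < ?e" for k
    using that by (simp add: N_def Q_def prod.remove[of "{..<?e}" k] mult.commute)
  \<comment> \<open>A lift of the part of \<open>c\<close> divisible by \<open>N\<close>; all its
    entries are divisible by \<open>NA\<close>, so adding it does not change the residue class seen
    by \<open>pA\<close>.\<close>
  define h where "h c = vec d (\<lambda>r. \<Sum>k<?e. (c $ k div N * (NA * Q k)) * A $$ (r, J k))" for c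
  define L where "L = (\<lambda>b. P *\<^sub>v b) ` lattice_of A"
  define resid where "resid c = vec ?e (\<lambda>k. c $ k mod N)" for c
  \<comment> \<open>An arbitrary lattice preimage suffices, since it is applied only to residue
    vectors and is therefore constant on each class.\<close>
  define \<beta> where "\<beta> c = (SOME b. b \<in> lattice_of A \<and> P *\<^sub>v b = c)" for c
  define lift where "lift c = \<beta> (resid c) + h c" for c
  \<comment> \<open>On classes outside the projected lattice the system for \<open>B\<close> has no
    solutions, hence the value 0.\<close>
  define pB where "pB c = (if resid c \<in> L then pA (lift c) else 0)" for c
  have h_lattice: "h c \<in> lattice_of A" for c
    using lattice_of_cols_sum[of "{..<?e}" J A] J unfolding h_def by simp
  have hc: "h c \<in> carrier_vec d" for c by (simp add: h_def)
  have Ph: "P *\<^sub>v h c + resid c = c" if c: "c \<in> carrier_vec ?e" for c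
  proof (rule eq_vecI)
    fix i assume "i < dim_vec c"
    then have i: "i < ?e" using c by simp
    have "(P *\<^sub>v h c) $ i = c $ i div N * N"
      unfolding h_def scale[OF i] by (subst (2) NQ[OF i]) simp
    then show "(P *\<^sub>v h c + resid c) $ i = c $ i" using i by (simp add: resid_def)
  qed (use c in \<open>simp add: resid_def\<close>)
  have h_mod: "h c $ i mod NA = 0" if "i < d" for c i
  proof -
    have "h c $ i = NA * (\<Sum>k<?e. (c $ k div N * Q k) * A $$ (i, J k))"
      using that by (simp add: h_def sum_distrib_left mult_ac)
    then show ?thesis by simp
  qed
  have Lc: "c \<in> carrier_vec ?e" if "c \<in> L" for c 
    using that P lattice_of_carrier unfolding L_def by (auto intro!: mult_mat_vec_carrier)
  have \<beta>: "\<beta> c \<in> lattice_of A" "P *\<^sub>v \<beta> c = c" if "c \<in> L" for c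
  proof -
    have "\<exists>b. b \<in> lattice_of A \<and> P *\<^sub>v b = c" using that by (auto simp: L_def)
    from someI_ex[OF this] show "\<beta> c \<in> lattice_of A" "P *\<^sub>v \<beta> c = c" by (auto simp: \<beta>_def)
  qed
  \<comment> \<open>A vector and its residue differ by the projection of \<open>h c\<close>, so a
    residue outside the projected lattice excludes the vector as well.\<close>
  have resid_L: "resid c \<in> L" if "c \<in> L" for c
  proof -
    obtain b where b: "b \<in> lattice_of A" "c = P *\<^sub>v b" using \<open>c \<in> L\<close> by (auto simp: L_def)
    have m: "b + (-1) \<cdot>\<^sub>v h c \<in> lattice_of A" using b h_lattice by (intro lattice_of_add lattice_of_smult)
    have bc: "b \<in> carrier_vec d" using lattice_of_carrier b by blast
    have "P *\<^sub>v (b + (-1) \<cdot>\<^sub>v h c) = P *\<^sub>v b + (-1) \<cdot>\<^sub>v (P *\<^sub>v h c)"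
      using bc hc P by (simp add: mult_add_distrib_mat_vec[of _ ?e d] mult_mat_vec_smult[of _ ?e d])
    also have "\<dots> = c + (-1) \<cdot>\<^sub>v (P *\<^sub>v h c)" using b by simp
    also have "\<dots> = resid c"
    proof (rule eq_vecI)
      fix i assume "i < dim_vec (resid c)"
      then have i: "i < ?e" by (simp add: resid_def)
      have "(P *\<^sub>v h c + resid c) $ i = c $ i" using Ph[OF Lc[OF that]] by simp
      then show "(c + (-1) \<cdot>\<^sub>v (P *\<^sub>v h c)) $ i = resid c $ i"
        using i Lc[OF that] by (simp add: resid_def)
    qed (use Lc[OF that] in \<open>simp add: resid_def\<close>)
    finally show ?thesis unfolding L_def using m by (metis imageI)
  qed
  have lift: "lift c \<in> lattice_of A" "P *\<^sub>v lift c = c" if c: "c \<in> carrier_vec ?e" "resid c \<in> L" for c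
  proof -
    show "lift c \<in> lattice_of A" unfolding lift_def using \<beta>(1)[OF c(2)] h_lattice by (rule lattice_of_add)
    have "P *\<^sub>v lift c = P *\<^sub>v \<beta> (resid c) + P *\<^sub>v h c"
      unfolding lift_def using lattice_of_carrier[OF \<beta>(1)[OF c(2)]] hc P
      by (intro mult_add_distrib_mat_vec[of _ ?e d]) auto
    also have "\<dots> = P *\<^sub>v h c + resid c"
      unfolding \<beta>(2)[OF c(2)]
      by (rule comm_add_vec[of _ ?e]) (use P hc in \<open>auto simp: resid_def intro: mult_mat_vec_carrier\<close>)
    also have "\<dots> = c" by (rule Ph[OF c(1)])
    finally show "P *\<^sub>v lift c = c" .
  qed
  have "quasi_polynomial ?e pB"
    unfolding quasi_polynomial_def
  proof (intro exI[of _ N] conjI ballI)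
    show "N > 0" by (rule N)
    fix r :: "int vec" assume "r \<in> carrier_vec ?e"
    have res: "resid c = resid r" if "\<forall>i<?e. c $ i mod N = r $ i mod N" for c
      using that by (auto simp: resid_def)
    show "\<exists>g. polynomial_fun ?e g \<and>
        (\<forall>b\<in>carrier_vec ?e. (\<forall>i<?e. b $ i mod N = r $ i mod N) \<longrightarrow> pB b = g b)"
    proof (cases "resid r \<in> L")
      case False
      then show ?thesis
        unfolding pB_def by (intro exI[of _ "\<lambda>_. 0"] conjI polynomial_fun_const ballI impI) (subst res; simp)
    next
      case True
      let ?b = "\<beta> (resid r)"
      have bc: "?b \<in> carrier_vec d" using lattice_of_carrier[OF \<beta>(1)[OF True]] .
      obtain gA where gA: "polynomial_fun d gA"
        "\<And>b. b \<in> carrier_vec d \<Longrightarrow> (\<forall>i<d. b $ i mod NA = ?b $ i mod NA) \<Longrightarrow> pA b = gA b"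
        using qp[OF bc] by blast
      \<comment> \<open>On a fixed residue class the integer quotient by \<open>N\<close> becomes
        exact rational division, which makes each entry of the lift affine in \<open>c\<close>, with
        slope determined by 1 / D k.\<close>
      define F where "F i c = of_int (?b $ i) + (\<Sum>k<?e. (of_int (c $ k) + of_int (- resid r $ k)) *
          (inverse (of_int (D k)) * of_int (A $$ (i, J k)) :: rat))" for i and c :: "int vec"
      have F: "polynomial_fun ?e (F i)" for i
        unfolding F_def
        by (intro polynomial_fun_add polynomial_fun_const polynomial_fun_sum polynomial_fun_mult
            polynomial_fun_coord) auto
      obtain g where g: "polynomial_fun ?e g"
        "\<forall>b\<in>carrier_vec d. \<forall>c. (\<forall>i<d. of_int (b $ i) = F i c) \<longrightarrow> gA b = g c"
        using polynomial_fun_subst[OF gA(1), where F = F and m = ?e, OF F] by blast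
      have "pB c = g c" if c: "c \<in> carrier_vec ?e" "\<forall>i<?e. c $ i mod N = r $ i mod N" for c
      proof -
        have rc: "resid c = resid r" using res c(2) by blast
        have lc: "lift c \<in> carrier_vec d" using bc hc by (simp add: lift_def rc)
        have lift_i: "lift c $ i = ?b $ i + h c $ i" if "i < d" for i
          using that bc by (simp add: lift_def rc h_def)
        have "of_int (lift c $ i) = F i c" if i: "i < d" for i
        proof -
          have "of_int (h c $ i) = (\<Sum>k<?e. of_int (c $ k div N * (NA * Q k)) * (of_int (A $$ (i, J k)) :: rat))"
            using i by (simp add: h_def)
          also have "\<dots> = (\<Sum>k<?e. (of_int (c $ k) + of_int (- resid r $ k)) *
              (inverse (of_int (D k)) * of_int (A $$ (i, J k))))"
          proof (rule sum.cong)
            fix k assume "k \<in> {..<?e}"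
            then have k: "k < ?e" by simp
            have "c $ k div N * (NA * Q k) * D k = c $ k div N * N" by (subst (2) NQ[OF k]) simp
            also have "\<dots> = c $ k - resid r $ k"
              using k unfolding rc[symmetric] by (simp add: resid_def minus_mod_eq_div_mult)
            finally have "of_int (c $ k div N * (NA * Q k)) * (of_int (D k) :: rat)
                = of_int (c $ k) + of_int (- resid r $ k)"
              by (metis of_int_mult of_int_add diff_conv_add_uminus)
            moreover have "(of_int (D k) :: rat) \<noteq> 0" using D[OF k] by simp
            ultimately have "of_int (c $ k div N * (NA * Q k))
                = (of_int (c $ k) + of_int (- resid r $ k)) * inverse (of_int (D k) :: rat)"
              by (simp add: field_simps)
            then show "of_int (c $ k div N * (NA * Q k)) * (of_int (A $$ (i, J k)) :: rat)
                = (of_int (c $ k) + of_int (- resid r $ k)) * (inverse (of_int (D k)) * of_int (A $$ (i, J k)))"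
              by (simp only: mult.assoc)
          qed simp
          finally show ?thesis using lift_i[OF i] by (simp add: F_def)
        qed
        then have "gA (lift c) = g c" using g(2) lc by blast
        moreover have "pA (lift c) = gA (lift c)"
        proof (rule gA(2)[OF lc], intro allI impI)
          fix i assume "i < d"
          then show "lift c $ i mod NA = ?b $ i mod NA"
            using lift_i h_mod by (simp add: mod_add_eq[symmetric, of "?b $ i"])
        qed
        ultimately show ?thesis using True rc by (simp add: pB_def)
      qed
      then show ?thesis using g(1) by blast
    qed
  qed
  moreover have pB_vpf: "pB c = of_nat (vpf B c)" if c: "c \<in> carrier_vec ?e" "real_vec c \<in> proj ` \<gamma>" for c
  proof (cases "resid c \<in> L")
    case False
    then have "c \<notin> L" using resid_L by blast
    then show ?thesis using vpf_B_outside_lattice False by (simp add: L_def pB_def)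
  next
    case True
    let ?b = "lift c"
    have b: "?b \<in> lattice_of A" "P *\<^sub>v ?b = c" using lift[OF c(1) True] .
    have bc: "?b \<in> carrier_vec d" using lattice_of_carrier[OF b(1)] .
    obtain y where y: "y \<in> \<gamma>" "real_vec c = proj y" using c(2) by blast
    have yc: "y \<in> carrier_vec d" using y(1) \<gamma>_carrier by blast
    have "proj (real_vec ?b - y) = proj (real_vec ?b) - proj y" using bc yc by (intro proj_diff) auto
    also have "\<dots> = real_vec c - real_vec c" using y(2) b(2) real_proj[OF bc] by simp
    also have "\<dots> = 0\<^sub>v ?e" using c(1) by (intro minus_cancel_vec) simp
    finally have "proj (real_vec ?b - y) = 0\<^sub>v ?e" .
    then obtain x where x: "real_vec ?b - y = comb A {..<l} x"
      using P_ker[of "real_vec ?b - y"] bc yc by auto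
    \<comment> \<open>\<open>NA\<close> times the sum of the first \<open>l\<close> columns: it
      projects to zero and is divisible by \<open>NA\<close>, so along this direction the image
      point and the polynomial governing \<open>pA\<close> remain the same.\<close>
    define a where "a = A *\<^sub>v vec n (\<lambda>j. if j < l then NA else 0)"
    have a: "a \<in> lattice_of A" by (auto simp: a_def lattice_of_def)
    have ac: "a \<in> carrier_vec d" using lattice_of_carrier[OF a] .
    have real_a: "real_vec a = comb A {..<l} (\<lambda>_. of_int NA)"
    proof -
      have "real_vec a = comb A {..<n} (\<lambda>j. if j \<in> {..<l} then of_int NA else 0)"
        unfolding a_def by (subst real_mult_mat_vec_comb) (auto intro: comb_cong)
      then show ?thesis using comb_superset[of "{..<n}" "{..<l}" A] l_le_n by simp
    qed
    have a_mod: "a $ i mod NA = 0" if "i < d" for i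
    proof -
      have "a $ i = NA * (\<Sum>j<n. A $$ (i, j) * (if j < l then 1 else 0))"
        using that by (simp add: a_def scalar_prod_def atLeast0LessThan sum_distrib_left)
          (auto intro!: sum.cong)
      then show ?thesis by simp
    qed
    have "real_vec (P *\<^sub>v a) = real_vec (0\<^sub>v ?e)"
      using real_proj[OF ac] real_a proj_comb_first by auto
    then have Pa: "P *\<^sub>v a = 0\<^sub>v ?e" by (simp only: real_vec_eq_iff)
    obtain gA where gA: "polynomial_fun d gA"
      "\<And>b'. b' \<in> carrier_vec d \<Longrightarrow> (\<forall>i<d. b' $ i mod NA = ?b $ i mod NA) \<Longrightarrow> pA b' = gA b'"
      using qp[OF bc] by blast
    obtain p where p: "\<And>m. gA (?b + m \<cdot>\<^sub>v a) = poly p (of_int m)"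
      using polynomial_fun_on_line[OF gA(1) ac bc] by blast
    have pAp: "pA (?b + m \<cdot>\<^sub>v a) = poly p (of_int m)" for m
    proof -
      have "(?b + m \<cdot>\<^sub>v a) $ i mod NA = ?b $ i mod NA" if i: "i < d" for i
      proof -
        have "NA dvd m * a $ i" using a_mod[OF i] by (simp add: mod_eq_0_iff_dvd)
        then show ?thesis using i ac bc by (auto elim!: dvdE)
      qed
      then show ?thesis using gA(2)[of "?b + m \<cdot>\<^sub>v a"] p ac bc by simp
    qed
    \<comment> \<open>The sum dominates every |x j|; as \<open>NA\<close> is at least 1, adding m *
      NA makes all coefficients nonnegative for m \<ge> m0.\<close>
    define m0 where "m0 = (\<Sum>j<l. \<lceil>\<bar>x j\<bar>\<rceil>)"
    have "poly p (of_int m) = of_nat (vpf B c)" if m: "m \<ge> m0" for m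
    proof -
      let ?bm = "?b + m \<cdot>\<^sub>v a"
      have bm: "?bm \<in> lattice_of A" using a b by (intro lattice_of_add lattice_of_smult)
      have "real_vec ?bm = y + comb A {..<l} (\<lambda>j. x j + of_int m * of_int NA)"
      proof -
        have "real_vec ?bm = real_vec ?b + of_int m \<cdot>\<^sub>v real_vec a"
          using bc ac by (intro eq_vecI) auto
        also have "\<dots> = y + (real_vec ?b - y) + of_int m \<cdot>\<^sub>v real_vec a"
          using bc yc ac by (intro eq_vecI) auto
        also have "\<dots> = y + comb A {..<l} x + comb A {..<l} (\<lambda>_. of_int m * of_int NA)"
          unfolding x real_a comb_smult ..
        also have "\<dots> = y + comb A {..<l} (\<lambda>j. x j + of_int m * of_int NA)"
          unfolding comb_add using yc by (intro assoc_add_vec[of _ d]) auto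
        finally show ?thesis .
      qed
      moreover have "0 \<le> x j + of_int m * of_int NA" if j: "j < l" for j
      proof -
        have "\<lceil>\<bar>x j\<bar>\<rceil> \<le> m0" unfolding m0_def
          using j by (intro member_le_sum[of j "{..<l}" "\<lambda>j. \<lceil>\<bar>x j\<bar>\<rceil>"]) auto
        then have "\<bar>x j\<bar> \<le> of_int m" using m by linarith
        moreover have "of_int m * 1 \<le> of_int m * (of_int NA :: real)"
          using \<open>\<bar>x j\<bar> \<le> of_int m\<close> NA by (intro mult_left_mono) auto
        ultimately show ?thesis by linarith
      qed
      ultimately have in_\<gamma>: "real_vec ?bm \<in> \<gamma>" using add_first_columns[OF y(1)] by simp
      have "m \<cdot>\<^sub>v 0\<^sub>v ?e = (0\<^sub>v ?e :: int vec)" by auto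
      then have "P *\<^sub>v ?bm = c"
        using b(2) Pa bc ac P c(1) by (simp add: mult_add_distrib_mat_vec[of _ ?e d] mult_mat_vec_smult[of _ ?e d])
      then have "vpf A ?bm = vpf B c" using vpf_projection[OF bm in_\<gamma>] by simp
      then show ?thesis using agree[OF lattice_of_carrier[OF bm] in_\<gamma>] pAp by simp
    qed
    \<comment> \<open>Only the value at 0 matters, the lift itself, although the solution counts
      were compared only far out on the line.\<close>
    then have "poly p 0 = of_nat (vpf B c)" by (rule poly_eventually_const)
    moreover have "?b + 0 \<cdot>\<^sub>v a = ?b" using bc ac by auto
    ultimately show ?thesis using pAp[of 0] True by (simp add: pB_def)
  qed
  ultimately have "chamber_qp B (proj ` \<gamma>) pB" by (auto simp: chamber_qp_def)
  moreover have "pA b = pB (P *\<^sub>v b)" if b: "b \<in> lattice_of A" "real_vec b \<in> \<gamma>" for b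
  proof -
    have bc: "b \<in> carrier_vec d" using lattice_of_carrier[OF b(1)] .
    have "pB (P *\<^sub>v b) = of_nat (vpf B (P *\<^sub>v b))"
      using b(2) real_proj[OF bc] P bc by (intro pB_vpf) auto
    then show ?thesis using agree[OF bc b(2)] vpf_projection[OF b] by simp
  qed
  ultimately show thesis using that by blast
qed

end

subsection \<open>Dual ray matrices\<close>

lemma primitive_vec_nonzero:
  assumes "primitive_vec v"
  obtains k where "k < dim_vec v" "v $ k \<noteq> 0"
proof (rule ccontr)
  assume "\<not> thesis"
  then have "vec_set v \<subseteq> {0}" using that by (auto simp: vec_set_def)
  then have "Gcd (vec_set v) = 0" by (simp only: Gcd_0_iff)
  then show False using assms unfolding primitive_vec_def by (simp only: zero_neq_one)
qed

lemma primitive_vec_unique: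
  assumes v: "v \<in> carrier_vec d" "primitive_vec v" and w: "w \<in> carrier_vec d" "primitive_vec w"
    and c: "c > 0" "real_vec v = c \<cdot>\<^sub>v real_vec w"
  shows "v = w"
proof -
  have vi: "of_int (v $ i) = c * of_int (w $ i)" if "i < d" for i
    using arg_cong[OF c(2), of "\<lambda>u. u $ i"] v(1) w(1) that by simp
  obtain k where k: "k < d" "w $ k \<noteq> 0" using primitive_vec_nonzero[OF w(2)] w(1) by auto
  \<comment> \<open>Cross-multiplication eliminates the real factor \<open>c\<close> and leaves an
    identity of integers, to which gcds can be applied.\<close>
  have ratio: "w $ k * v $ i = v $ k * w $ i" if "i < d" for i
  proof -
    have "of_int (w $ k * v $ i) = (of_int (v $ k * w $ i) :: real)"
      using vi[OF that] vi[OF k(1)] by simp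
    then show ?thesis by (simp only: of_int_eq_iff)
  qed
  have "(*) (w $ k) ` vec_set v = (*) (v $ k) ` vec_set w"
    using v(1) w(1) ratio by (auto simp: vec_set_def image_image intro!: image_cong)
  then have "Gcd ((*) (w $ k) ` vec_set v) = Gcd ((*) (v $ k) ` vec_set w)" by simp
  \<comment> \<open>Both gcds are 1, so the two multipliers agree up to sign; positivity of
    \<open>c\<close> settles the sign.\<close>
  then have "\<bar>w $ k\<bar> = \<bar>v $ k\<bar>" using v(2) w(2) by (simp add: Gcd_mult primitive_vec_def)
  moreover have "sgn (v $ k) = sgn (w $ k)"
  proof -
    have "sgn (of_int (v $ k) :: real) = sgn (of_int (w $ k))"
      using vi[OF k(1)] c(1) by (simp add: sgn_mult)
    then show ?thesis by (auto simp: sgn_if split: if_splits)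
  qed
  ultimately have "w $ k = v $ k" by (metis abs_mult_sgn)
  then have "v $ i = w $ i" if "i < d" for i using ratio[OF that] k(2) by simp
  then show ?thesis using v(1) w(1) by (intro eq_vecI) auto
qed

lemma pos_cone_ray:
  assumes v: "v \<in> carrier_vec d"
  shows "pos_cone (mat_of_cols d [v]) = {c \<cdot>\<^sub>v real_vec v | c. 0 \<le> c}"
proof -
  have *: "comb (mat_of_cols d [v]) {..<Suc 0} x = x 0 \<cdot>\<^sub>v real_vec v" for x
    using v by (auto simp: comb_def mat_of_cols_def lessThan_Suc intro!: eq_vecI)
  have "pos_cone (mat_of_cols d [v]) = {x 0 \<cdot>\<^sub>v real_vec v | x. \<forall>j\<in>{..<Suc 0}. 0 \<le> x j}"
    by (simp add: pos_cone_eq_col_cone col_cone_def *)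
  also have "\<dots> = {c \<cdot>\<^sub>v real_vec v | c. 0 \<le> c}"
  proof (intro equalityI subsetI)
    fix u assume "u \<in> {c \<cdot>\<^sub>v real_vec v | c. 0 \<le> c}"
    then obtain c where "0 \<le> c" "u = c \<cdot>\<^sub>v real_vec v" by blast
    then show "u \<in> {x 0 \<cdot>\<^sub>v real_vec v | x. \<forall>j\<in>{..<Suc 0}. 0 \<le> x j}"
      by (intro CollectI exI[of _ "\<lambda>_. c"]) auto
  qed auto
  finally show ?thesis .
qed

lemma col_mem_col_cone:
  assumes "finite s" "j \<in> s" "j < dim_col A"
  shows "real_vec (col A j) \<in> col_cone A s"
proof -
  have "real_vec (col A j) = comb A s (\<lambda>k. if k = j then 1 else 0)"
    using comb_delta[OF assms, of 1] by simp
  moreover have "\<forall>k\<in>s. 0 \<le> (if k = j then 1 else (0::real))" by simp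
  ultimately show ?thesis unfolding col_cone_def by blast
qed

text \<open>The functional that cuts out the ray is nonnegative on all columns and zero on
  \<open>v\<close>, hence zero on every column that occurs in \<open>v\<close> with a positive
  coefficient. Such a column lies on the ray itself.\<close>

lemma minimal_ray_generator_col:
  assumes s: "col_basis A s" and v: "v \<in> minimal_ray_generators (dim_row A) (col_cone A s)"
  shows "real_vec v \<in> col_cone A s" "\<exists>i\<in>s. \<exists>c>0. real_vec (col A i) = c \<cdot>\<^sub>v real_vec v"
proof -
  let ?d = "dim_row A"
  have fin: "finite s" using col_basis_finite[OF s] .
  have sub: "s \<subseteq> {..<dim_col A}" using s by (simp add: col_basis_def)
  have vc: "v \<in> carrier_vec ?d" and prim: "primitive_vec v"
    using v by (auto simp: minimal_ray_generators_def)
  obtain u where u: "u \<in> carrier_vec ?d" "\<forall>x\<in>col_cone A s. 0 \<le> u \<bullet> x"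
    and ray: "{c \<cdot>\<^sub>v real_vec v | c. 0 \<le> c} = {x \<in> col_cone A s. u \<bullet> x = 0}"
    using v vc by (auto simp: minimal_ray_generators_def is_face_def pos_cone_ray)
  have "real_vec v = 1 \<cdot>\<^sub>v real_vec v" by simp
  then have "real_vec v \<in> {x \<in> col_cone A s. u \<bullet> x = 0}"
    unfolding ray[symmetric] by (metis (mono_tags, lifting) mem_Collect_eq zero_le_one)
  then have v\<sigma>: "real_vec v \<in> col_cone A s" and uv: "u \<bullet> real_vec v = 0" by auto
  show "real_vec v \<in> col_cone A s" by (rule v\<sigma>)
  obtain x where x: "\<forall>j\<in>s. 0 \<le> x j" "real_vec v = comb A s x" using v\<sigma> by (auto simp: col_cone_def)
  have "\<exists>i\<in>s. x i \<noteq> 0"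
  proof (rule ccontr)
    assume "\<not> (\<exists>i\<in>s. x i \<noteq> 0)"
    then have "real_vec v = real_vec (0\<^sub>v ?d)" unfolding x(2) by (auto simp: comb_def)
    then have "v = 0\<^sub>v ?d" by (simp only: real_vec_eq_iff)
    then show False using primitive_vec_nonzero[OF prim] by auto
  qed
  then obtain i where i: "i \<in> s" "x i \<noteq> 0" by blast
  have cols: "real_vec (col A j) \<in> col_cone A s" if "j \<in> s" for j
    using col_mem_col_cone[OF fin that] that sub by auto
  have "(\<Sum>j\<in>s. x j * (u \<bullet> real_vec (col A j))) = 0"
    using uv scalar_prod_comb[OF u(1) sub, of x] x(2) by simp
  moreover have "0 \<le> x j * (u \<bullet> real_vec (col A j))" if "j \<in> s" for j
    using that x(1) u(2) cols[OF that] by (intro mult_nonneg_nonneg) auto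
  ultimately have "x i * (u \<bullet> real_vec (col A i)) = 0"
    using sum_nonneg_eq_0_iff[OF fin, of "\<lambda>j. x j * (u \<bullet> real_vec (col A j))"] i(1) by simp
  then have "real_vec (col A i) \<in> {c \<cdot>\<^sub>v real_vec v | c. 0 \<le> c}" unfolding ray using i cols by simp
  then obtain c where c: "0 \<le> c" "real_vec (col A i) = c \<cdot>\<^sub>v real_vec v" by blast
  \<comment> \<open>A column of a basis is not zero, since its own coordinate functional takes the
    value 1 there.\<close>
  have "c \<noteq> 0"
  proof
    assume "c = 0"
    then have "real_vec (col A i) = 0\<^sub>v ?d" using c(2) vc by auto
    then have "dual_basis A s i \<bullet> real_vec (col A i) = 0" 
      using dual_basis_carrier[OF s, of i] by (simp only: scalar_prod_right_zero)
    then show False using dual_basis_col[OF s i(1) i(1)] by simp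
  qed
  then show "\<exists>i\<in>s. \<exists>c>0. real_vec (col A i) = c \<cdot>\<^sub>v real_vec v" using c i(1) by (metis less_eq_real_def)
qed

lemma cone_dim_col_cone:
  assumes s: "col_basis A s"
  shows "cone_dim (dim_row A) (col_cone A s) = dim_row A"
proof (rule cone_dim_full[OF col_cone_carrier])
  fix v :: "real vec" assume "v \<in> carrier_vec (dim_row A)"
  then obtain y where y: "v = comb A s y" using comb_dual_basis[OF s] by metis
  have "v = comb A s (\<lambda>j. max (y j) 0 - max (- y j) 0)" unfolding y by (intro comb_cong) auto
  then have "v = comb A s (\<lambda>j. max (y j) 0) - comb A s (\<lambda>j. max (- y j) 0)" by (simp add: comb_diff)
  moreover have "comb A s (\<lambda>j. max (y j) 0) \<in> col_cone A s" "comb A s (\<lambda>j. max (- y j) 0) \<in> col_cone A s"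
    by (auto simp: col_cone_def)
  ultimately show "\<exists>x\<in>col_cone A s. \<exists>y\<in>col_cone A s. v = x - y" by blast
qed

text \<open>If the normal were nonzero on two generators, the face would lie in the span of the
  remaining d - 2 columns, which is too small for a facet.\<close>

lemma facet_normal_vanishes:
  assumes s: "col_basis A s" and w: "w \<in> carrier_vec (dim_row A)" "\<forall>x\<in>col_cone A s. 0 \<le> w \<bullet> x"
    and F: "F = {x \<in> col_cone A s. w \<bullet> x = 0}" "is_facet (dim_row A) F (col_cone A s)"
    and jk: "j \<in> s" "k \<in> s" "j \<noteq> k" and wj: "w \<bullet> real_vec (col A j) \<noteq> 0"
  shows "w \<bullet> real_vec (col A k) = 0"
proof (rule ccontr)
  assume wk: "w \<bullet> real_vec (col A k) \<noteq> 0"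
  have fin: "finite s" using col_basis_finite[OF s] .
  have sub: "s \<subseteq> {..<dim_col A}" and card: "card s = dim_row A" using s by (auto simp: col_basis_def)
  have "cone_dim (dim_row A) F \<le> card (s - {j, k})"
  proof (rule cone_dim_le_card[of _ "\<lambda>i. real_vec (col A i)"])
    fix v assume "v \<in> F"
    then obtain x where x: "\<forall>i\<in>s. 0 \<le> x i" "v = comb A s x" and wv: "w \<bullet> v = 0"
      by (auto simp: F(1) col_cone_def)
    have "(\<Sum>i\<in>s. x i * (w \<bullet> real_vec (col A i))) = 0"
      using wv scalar_prod_comb[OF w(1) sub, of x] x(2) by simp
    moreover have "0 \<le> x i * (w \<bullet> real_vec (col A i))" if "i \<in> s" for i
    proof -
      have "real_vec (col A i) \<in> col_cone A s" using col_mem_col_cone[OF fin that] that sub by auto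
      then show ?thesis using that x(1) w(2) by (intro mult_nonneg_nonneg) auto
    qed
    ultimately have "x i * (w \<bullet> real_vec (col A i)) = 0" if "i \<in> s" for i
      using sum_nonneg_eq_0_iff[OF fin, of "\<lambda>i. x i * (w \<bullet> real_vec (col A i))"] that by simp
    then have x0: "x j = 0" "x k = 0" using jk wj wk by fastforce+
    have "comb A s x = vec (dim_row A) (\<lambda>r. \<Sum>i\<in>s - {j, k}. real_vec (col A i) $ r * x i)"
    proof (rule eq_vecI)
      fix r assume "r < dim_vec (vec (dim_row A) (\<lambda>r. \<Sum>i\<in>s - {j, k}. real_vec (col A i) $ r * x i))"
      then have r: "r < dim_row A" by simp
      have "(\<Sum>i\<in>s. of_int (A $$ (r, i)) * x i) = (\<Sum>i\<in>s - {j, k}. of_int (A $$ (r, i)) * x i)"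
        using fin x0 by (intro sum.mono_neutral_right) auto
      also have "\<dots> = (\<Sum>i\<in>s - {j, k}. real_vec (col A i) $ r * x i)"
        using sub r by (intro sum.cong) auto
      finally show "comb A s x $ r = vec (dim_row A) (\<lambda>r. \<Sum>i\<in>s - {j, k}. real_vec (col A i) $ r * x i) $ r"
        using r by (simp add: index_comb)
    qed simp
    then show "\<exists>x. v = vec (dim_row A) (\<lambda>r. \<Sum>i\<in>s - {j, k}. real_vec (col A i) $ r * x i)"
      using x(2) by blast
  qed (use fin in auto)
  moreover have "cone_dim (dim_row A) F + 1 = dim_row A"
    using F(2) cone_dim_col_cone[OF s] by (simp add: is_facet_def)
  moreover have "card (s - {j, k}) + 2 = card s"
  proof -
    have "card (s - {j, k}) = card s - card {j, k}" using jk fin by (intro card_Diff_subset) auto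
    moreover have "card {j, k} \<le> card s" using jk fin by (intro card_mono) auto
    ultimately show ?thesis using jk(3) by simp
  qed
  ultimately show False using card by simp
qed

lemma real_scalar_prod:
  assumes "dim_vec v = dim_vec w"
  shows "real_vec v \<bullet> real_vec w = of_int (v \<bullet> w)"
  using assms by (simp add: scalar_prod_def)

text \<open>Matches the ray generators with the columns of the basis. In this order the rows of
  \<open>M\<close> form the dual basis up to positive factors; these factors remain because columns
  need not be primitive and because normals are scaled to be primitive.\<close>

lemma dual_ray_matrix_cols:
  assumes s: "col_basis A s" and d: "dim_row A = d"
    and rays: "distinct vs" "length vs = d" "set vs = minimal_ray_generators d (col_cone A s)"
    and dual: "dual_ray_matrix d (col_cone A s) vs M"
  obtains \<tau> where "bij_betw \<tau> {..<d} s"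
    "\<And>i. i < d \<Longrightarrow> \<exists>c>0. real_vec (col A (\<tau> i)) = c \<cdot>\<^sub>v real_vec (vs ! i)"
    "\<And>i. i < d \<Longrightarrow> 0 < row M i \<bullet> col A (\<tau> i)"
    "\<And>i j. i < d \<Longrightarrow> j < d \<Longrightarrow> i \<noteq> j \<Longrightarrow> row M i \<bullet> col A (\<tau> j) = 0"
proof -
  have fin: "finite s" using col_basis_finite[OF s] .
  have sub: "s \<subseteq> {..<dim_col A}" and card: "card s = d" using s d by (auto simp: col_basis_def)
  have M: "M \<in> carrier_mat d d" using dual by (simp add: dual_ray_matrix_def)
  have vmem: "vs ! i \<in> minimal_ray_generators d (col_cone A s)" if "i < d" for i
    using that rays by (metis nth_mem)
  have vprop: "vs ! i \<in> carrier_vec d" "primitive_vec (vs ! i)" if "i < d" for i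
    using vmem[OF that] by (auto simp: minimal_ray_generators_def)
  have "\<exists>j\<in>s. \<exists>c>0. real_vec (col A j) = c \<cdot>\<^sub>v real_vec (vs ! i)" if "i < d" for i
    using minimal_ray_generator_col(2)[OF s] vmem[OF that] d by simp
  then obtain \<tau> where \<tau>: "\<And>i. i < d \<Longrightarrow> \<tau> i \<in> s"
      "\<And>i. i < d \<Longrightarrow> \<exists>c>0. real_vec (col A (\<tau> i)) = c \<cdot>\<^sub>v real_vec (vs ! i)"
    by metis
  have inj: "inj_on \<tau> {..<d}"
  proof (rule inj_onI)
    fix i j assume "i \<in> {..<d}" "j \<in> {..<d}" and eq: "\<tau> i = \<tau> j"
    then have ij: "i < d" "j < d" by auto
    obtain a where a: "a > 0" "real_vec (col A (\<tau> i)) = a \<cdot>\<^sub>v real_vec (vs ! i)" using \<tau>(2)[OF ij(1)] by blast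
    obtain b where b: "b > 0" "real_vec (col A (\<tau> j)) = b \<cdot>\<^sub>v real_vec (vs ! j)" using \<tau>(2)[OF ij(2)] by blast
    \<comment> \<open>Two ray generators that share a column are positive multiples of each other,
      and primitive vectors with this property are equal.\<close>
    have "real_vec (vs ! i) = (1 / a) \<cdot>\<^sub>v (a \<cdot>\<^sub>v real_vec (vs ! i))" using a(1) by (simp add: smult_smult_assoc)
    also have "a \<cdot>\<^sub>v real_vec (vs ! i) = b \<cdot>\<^sub>v real_vec (vs ! j)" using a(2) b(2) eq by simp
    also have "(1 / a) \<cdot>\<^sub>v (b \<cdot>\<^sub>v real_vec (vs ! j)) = (b / a) \<cdot>\<^sub>v real_vec (vs ! j)"
      by (simp add: smult_smult_assoc)
    finally have "vs ! i = vs ! j"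
      using primitive_vec_unique[of "vs ! i" d "vs ! j" "b / a"] vprop ij a(1) b(1) by simp
    then show "i = j" using rays ij by (simp add: nth_eq_iff_index_eq)
  qed
  have bij: "bij_betw \<tau> {..<d} s"
    unfolding bij_betw_def using inj \<tau>(1) card card_image[OF inj] card_subset_eq[OF fin, of "\<tau> ` {..<d}"] by auto
  have normal: "0 < row M i \<bullet> col A (\<tau> i) \<and> (\<forall>j<d. i \<noteq> j \<longrightarrow> row M i \<bullet> col A (\<tau> j) = 0)" if i: "i < d" for i
  proof -
    let ?w = "real_vec (row M i)"
    obtain F where F: "is_facet d F (col_cone A s)" "real_vec (vs ! i) \<notin> F"
      "\<forall>x\<in>col_cone A s. 0 \<le> ?w \<bullet> x" "F = {x \<in> col_cone A s. ?w \<bullet> x = 0}"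
      using dual i unfolding dual_ray_matrix_def primitive_inner_normal_def by blast
    have w: "?w \<in> carrier_vec (dim_row A)" using M d i by simp
    have wint: "?w \<bullet> real_vec (col A j) = of_int (row M i \<bullet> col A j)" for j
      using M d by (intro real_scalar_prod) simp
    have cols: "real_vec (col A j) \<in> col_cone A s" if "j \<in> s" for j
      using col_mem_col_cone[OF fin that] that sub by auto
    have "real_vec (vs ! i) \<in> col_cone A s"
      using minimal_ray_generator_col(1)[OF s] vmem[OF i] d by simp
    then have wv: "?w \<bullet> real_vec (vs ! i) \<noteq> 0" using F(2,4) by blast
    obtain c where c: "c > 0" "real_vec (col A (\<tau> i)) = c \<cdot>\<^sub>v real_vec (vs ! i)" using \<tau>(2)[OF i] by blast
    have "?w \<bullet> real_vec (col A (\<tau> i)) = c * (?w \<bullet> real_vec (vs ! i))"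
      unfolding c(2) using M vprop(1)[OF i] d by (intro scalar_prod_smult_right) simp
    then have ne: "?w \<bullet> real_vec (col A (\<tau> i)) \<noteq> 0" using wv c(1) by simp
    moreover have "0 \<le> ?w \<bullet> real_vec (col A (\<tau> i))" using F(3) cols[OF \<tau>(1)[OF i]] by blast
    ultimately have "0 < row M i \<bullet> col A (\<tau> i)" unfolding wint by simp
    moreover have "row M i \<bullet> col A (\<tau> j) = 0" if j: "j < d" "i \<noteq> j" for j
    proof -
      have "\<tau> i \<noteq> \<tau> j" using inj i j by (auto simp: inj_on_def)
      then have "?w \<bullet> real_vec (col A (\<tau> j)) = 0"
        using facet_normal_vanishes[OF s w F(3,4) _ \<tau>(1)[OF i] \<tau>(1)[OF j(1)] _ ne] F(1) d by simp
      then show ?thesis unfolding wint by simp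
    qed
    ultimately show ?thesis by blast
  qed
  show thesis using that[OF bij \<tau>(2)] normal by blast
qed

section \<open>The dual ray matrix as a projection along external columns\<close>

theorem theorem4p2:
  fixes A M B :: "int mat" and d n l :: nat
    and \<gamma> \<sigma> :: "real vec set" and vs :: "int vec list" and pA :: "int vec \<Rightarrow> rat"
  assumes A: "A \<in> carrier_mat d n"
    and rank: "vec_space.rank d (real_mat A) = d"
    and ker: "mat_kernel (real_mat A) \<inter> {x \<in> carrier_vec n. 0\<^sub>v n \<le> x} = {0\<^sub>v n}"
    and chamber: "\<gamma> \<in> chambers A"
    and pA: "chamber_qp A \<gamma> pA"
    and ext: "{j. external_column A j \<and> real_vec (col A j) \<in> \<gamma>} = {..<l}"
    and sat: "saturated_in (cols_sub A {..<l}) A"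
    and simplicial: "\<sigma> \<in> simplicial_cones A" "\<gamma> \<subseteq> \<sigma>"
    and rays: "distinct vs" "length vs = d" "set vs = minimal_ray_generators d \<sigma>"
    and order: "\<forall>i<l. \<exists>c>0. real_vec (vs ! i) = c \<cdot>\<^sub>v real_vec (col A i)"
    and dual: "dual_ray_matrix d \<sigma> vs M"
    and B: "B = mat (d - l) (n - l) (\<lambda>(i, j). (M * A) $$ (l + i, l + j))"
  shows "\<exists>\<gamma>' pB. \<gamma>' \<in> chambers B \<and> chamber_qp B \<gamma>' pB \<and>
    (\<forall>b \<in> carrier_vec d. real_vec b \<in> \<gamma> \<and> b \<in> semigroup_of A \<longrightarrow>
       pA b = pB (vec (d - l) (\<lambda>i. (M *\<^sub>v b) $ (l + i))))"
proof -
  have dimA: "dim_row A = d" "dim_col A = n" using A by auto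
  have M: "M \<in> carrier_mat d d" using dual by (simp add: dual_ray_matrix_def)
  obtain s where s: "col_basis A s" and \<sigma>: "\<sigma> = col_cone A s"
    using simplicial(1) by (auto simp: simplicial_cones_eq)
  have fin: "finite s" using col_basis_finite[OF s] .
  have sub: "s \<subseteq> {..<n}" and card: "card s = d" using s dimA by (auto simp: col_basis_def)
  obtain b0 where b0: "b0 \<in> pos_cone A" "cell_bases A b0 \<noteq> {}" "\<gamma> = chamber_cell A b0"
    "cone_dim d \<gamma> = d"
    using chamber_is_cell[OF chamber simplicial] dimA by auto
  have l_s: "i \<in> s" if "i < l" for i
  proof -
    have "external_column A i" "real_vec (col A i) \<in> \<gamma>" using ext that by auto
    then show ?thesis using external_column_in_basis[of A i s] simplicial(2) \<sigma> sub dimA by auto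
  qed
  then have "card {..<l} \<le> card s" using fin by (intro card_mono) auto
  then have l_d: "l \<le> d" using card by simp
  obtain \<tau> where \<tau>: "bij_betw \<tau> {..<d} s"
    and \<tau>_ray: "\<And>i. i < d \<Longrightarrow> \<exists>c>0. real_vec (col A (\<tau> i)) = c \<cdot>\<^sub>v real_vec (vs ! i)"
    and \<tau>_pos: "\<And>i. i < d \<Longrightarrow> 0 < row M i \<bullet> col A (\<tau> i)"
    and \<tau>_zero: "\<And>i j. i < d \<Longrightarrow> j < d \<Longrightarrow> i \<noteq> j \<Longrightarrow> row M i \<bullet> col A (\<tau> j) = 0"
    using dual_ray_matrix_cols[OF s dimA(1) rays(1,2) _ _] rays(3) dual \<sigma> by metis
  have \<tau>_s: "\<tau> i \<in> s" if "i < d" for i using \<tau> that by (auto simp: bij_betw_def)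
  \<comment> \<open>Both column i and column \<tau> i lie on the ray of \<open>vs ! i\<close> and
    both belong to the basis \<open>s\<close>; independence leaves only \<tau> i = i.\<close>
  have \<tau>_l: "\<tau> i = i" if i: "i < l" for i
  proof (rule ccontr)
    assume ne: "\<tau> i \<noteq> i"
    have i_d: "i < d" using i l_d by simp
    obtain c where c: "real_vec (vs ! i) = c \<cdot>\<^sub>v real_vec (col A i)" using order i by blast
    obtain c' where c': "real_vec (col A (\<tau> i)) = c' \<cdot>\<^sub>v real_vec (vs ! i)" using \<tau>_ray[OF i_d] by blast
    let ?u = "dual_basis A s (\<tau> i)"
    have u: "?u \<in> carrier_vec d" using dual_basis_carrier[OF s] dimA by simp
    have "?u \<bullet> real_vec (col A (\<tau> i)) = (c' * c) * (?u \<bullet> real_vec (col A i))"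
      unfolding c' c smult_smult_assoc using u dimA by (intro scalar_prod_smult_right) auto
    then show False using dual_basis_col[OF s \<tau>_s[OF i_d]] \<tau>_s[OF i_d] l_s[OF i] ne by simp
  qed
  define P where "P = mat (d - l) d (\<lambda>(i, j). M $$ (l + i, j))"
  have P: "P \<in> carrier_mat (d - l) d" by (simp add: P_def)
  have rowP: "row P i = row M (l + i)" if "i < d - l" for i
    using that M by (intro eq_vecI) (auto simp: P_def)
  have P_index: "(P *\<^sub>v b) $ i = row M (l + i) \<bullet> b" if "i < d - l" for b i
    using that rowP P by simp
  interpret chamber_projection A P B d n l \<gamma> b0
  proof
    show "A \<in> carrier_mat d n" "cell_bases A b0 \<noteq> {}" "\<gamma> = chamber_cell A b0" "b0 \<in> pos_cone A"
      "cone_dim d \<gamma> = d" "P \<in> carrier_mat (d - l) d"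
      using A b0 P by auto
    show "{j. external_column A j \<and> real_vec (col A j) \<in> \<gamma>} = {..<l}" by (rule ext)
    show "saturated_in (cols_sub A {..<l}) A" by (rule sat)
    show "P *\<^sub>v col A j = 0\<^sub>v (d - l)" if j: "j < l" for j
    proof (rule eq_vecI)
      fix i assume "i < dim_vec (0\<^sub>v (d - l) :: int vec)"
      then have i: "i < d - l" by simp
      then show "(P *\<^sub>v col A j) $ i = 0\<^sub>v (d - l) $ i"
        using \<tau>_zero[of "l + i" j] \<tau>_l[OF j] j l_d by (simp add: P_index)
    qed (use P in simp)
    show "\<exists>j<n. \<exists>D>0. P *\<^sub>v col A j = D \<cdot>\<^sub>v unit_vec (d - l) k" if k: "k < d - l" for k
    proof (intro exI conjI)
      have lk: "l + k < d" using k by simp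
      show "\<tau> (l + k) < n" using \<tau>_s[OF lk] sub by auto
      show "0 < row M (l + k) \<bullet> col A (\<tau> (l + k))" by (rule \<tau>_pos[OF lk])
      show "P *\<^sub>v col A (\<tau> (l + k)) = (row M (l + k) \<bullet> col A (\<tau> (l + k))) \<cdot>\<^sub>v unit_vec (d - l) k"
      proof (rule eq_vecI)
        fix i assume "i < dim_vec ((row M (l + k) \<bullet> col A (\<tau> (l + k))) \<cdot>\<^sub>v unit_vec (d - l) k)"
        then have i: "i < d - l" by simp
        then show "(P *\<^sub>v col A (\<tau> (l + k))) $ i
            = ((row M (l + k) \<bullet> col A (\<tau> (l + k))) \<cdot>\<^sub>v unit_vec (d - l) k) $ i"
          using \<tau>_zero[of "l + i" "l + k"] k by (cases "i = k") (auto simp: P_index)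
      qed (use P in simp)
    qed
    show "\<exists>x. v = comb A {..<l} x" if v: "v \<in> carrier_vec d" and Pv: "real_mat P *\<^sub>v v = 0\<^sub>v (d - l)" for v
    proof -
      define y where "y j = dual_basis A s j \<bullet> v" for j
      have vy: "v = comb A s y" unfolding y_def using comb_dual_basis[OF s] v dimA by simp
      \<comment> \<open>Row i of \<open>M\<close> kills all basis columns except column \<tau> i,
        where it is positive, so it isolates this one coordinate of \<open>v\<close>.\<close>
      have y0: "y (\<tau> i) = 0" if i: "l \<le> i" "i < d" for i
      proof -
        let ?w = "real_vec (row M i)"
        have w: "?w \<in> carrier_vec (dim_row A)" using M i dimA by simp
        have il: "i - l < d - l" "l + (i - l) = i" using i by auto
        have "row (real_mat P) (i - l) = ?w"
          using il M i by (intro eq_vecI) (auto simp: P_def)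
        then have "?w \<bullet> v = (real_mat P *\<^sub>v v) $ (i - l)" using P il by simp
        then have "0 = ?w \<bullet> v" using Pv il by simp
        also have "\<dots> = (\<Sum>j\<in>s. y j * (?w \<bullet> real_vec (col A j)))"
          unfolding vy using sub dimA by (intro scalar_prod_comb[OF w]) simp
        also have "\<dots> = (\<Sum>k<d. y (\<tau> k) * (?w \<bullet> real_vec (col A (\<tau> k))))"
          by (rule sum.reindex_bij_betw[OF \<tau>, symmetric])
        also have "\<dots> = (\<Sum>k<d. y (\<tau> k) * of_int (row M i \<bullet> col A (\<tau> k)))"
          using M dimA by (intro sum.cong) (auto simp: real_scalar_prod)
        also have "\<dots> = (\<Sum>k<d. if k = i then y (\<tau> i) * of_int (row M i \<bullet> col A (\<tau> i)) else 0)"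
          using \<tau>_zero[OF i(2)] by (intro sum.cong) auto
        also have "\<dots> = y (\<tau> i) * of_int (row M i \<bullet> col A (\<tau> i))" using i by simp
        finally show ?thesis using \<tau>_pos[OF i(2)] by simp
      qed
      \<comment> \<open>Since \<tau> fixes the indices below \<open>l\<close>, a basis column
        outside them corresponds to one of the last d - l rows.\<close>
      have "y j = 0" if j: "j \<in> s" "\<not> j < l" for j
      proof -
        obtain i where i: "i < d" "j = \<tau> i" using \<tau> j(1) by (auto simp: bij_betw_def)
        then have "l \<le> i" using \<tau>_l[of i] j(2) by (metis linorder_not_le)
        then show ?thesis using y0 i by simp
      qed
      then have "comb A s y = comb A s (\<lambda>j. if j \<in> {..<l} then y j else 0)" by (intro comb_cong) auto
      also have "\<dots> = comb A {..<l} y" using l_s by (intro comb_superset[OF fin]) auto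
      finally show ?thesis using vy by blast
    qed
    show "B = mat (d - l) (n - l) (\<lambda>(i, j). (P *\<^sub>v col A (l + j)) $ i)"
      unfolding B using M A by (intro eq_matI) (auto simp: P_index)
  qed
  obtain pB where pB: "chamber_qp B (proj ` \<gamma>) pB"
    "\<And>b. b \<in> lattice_of A \<Longrightarrow> real_vec b \<in> \<gamma> \<Longrightarrow> pA b = pB (P *\<^sub>v b)"
    using quasi_polynomial_projection[OF pA] by blast
  have "pA b = pB (vec (d - l) (\<lambda>i. (M *\<^sub>v b) $ (l + i)))"
    if b: "b \<in> carrier_vec d" "real_vec b \<in> \<gamma>" "b \<in> semigroup_of A" for b
  proof -
    have "P *\<^sub>v b = vec (d - l) (\<lambda>i. (M *\<^sub>v b) $ (l + i))"
    proof (rule eq_vecI)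
      fix i assume "i < dim_vec (vec (d - l) (\<lambda>i. (M *\<^sub>v b) $ (l + i)))"
      then show "(P *\<^sub>v b) $ i = vec (d - l) (\<lambda>i. (M *\<^sub>v b) $ (l + i)) $ i"
        using M P_index[of i b] by simp
    qed simp
    moreover obtain x where "x \<in> carrier_vec (dim_col A)" "b = A *\<^sub>v map_vec int x"
      using b(3) by (auto simp: semigroup_of_def)
    \<comment> \<open>Natural coefficients are integers; the comparison of the two functions was
      established for lattice points of \<gamma>.\<close>
    then have "b \<in> lattice_of A" unfolding lattice_of_def using map_carrier_vec by blast
    ultimately show ?thesis using pB(2) b(2) by simp
  qed
  then show ?thesis using projected_chamber pB(1) by blast
qed

end
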